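(* Let $r\in\mathbb{Q}^\times$, and let $P_r$ be the finite set of primes $p$ with $v_p(r)\ne0$. For a prime $p\notin P_r$ define the locally analytic function $\Psi_{r,p}:\mathbb{Z}_p\to\mathbb{C}_p$ by $\Psi_{r,p}(s)=\langle r\rangle_p^{\,s}\,\Phi_{r,p}\big(\tfrac{s+1}{r}-1\big)$, and for $m\in\mathbb{Z}_{\ge0}$ let $\Psi_{r,\infty}(m)=e^r\int_r^\infty u^me^{-u}\,du$ (path integral of an entire function from $r$ to $+\infty$ along any path eventually on the positive real axis) and $\langle r\rangle_\infty=r$. Let $v,w\in(\{\text{primes}\}\setminus P_r)\cup\{\infty\}$. (i) For all $m\in\mathbb{Z}_{\ge0}$, $\langle r\rangle_v^{-m}\Psi_{r,v}(m)=\langle r\rangle_w^{-m}\Psi_{r,w}(m)$, and this common value is a rational number. (ii) $\Psi_{r,v}(m)=\Psi_{r,w}(m)$ for all $m\in\mathbb{Z}_{\ge0}$ divisible by $\mathrm{lcm}(\ell_v,\ell_w)$, where $\ell_p=p-1$ for a prime $p$ and $\ell_\infty=1$.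
   Context: $\mathbb{C}_p$ is the completion of an algebraic closure of $\mathbb{Q}_p$; $C(\mathbb{Z}_p,\mathbb{C}_p)$ the continuous functions $\mathbb{Z}_p\to\mathbb{C}_p$. $f_r(t)=-r\sum_{k\ge1}(-1)^k\binom{1/r}{k}t^k\in\mathbb{Q}[[t]]$. For $p\notin P_r$, $\phi_{r,p}\in C(\mathbb{Z}_p,\mathbb{C}_p)$ is the unique function with $\sum_{n\ge0}\phi_{r,p}(n)t^n/n!=\exp(f_r(t))$, and $\Phi_{r,p}(s)=S^s(\phi_{r,p})(-1)$ for $s\in\mathbb{Z}_p$, where $S^y(\phi)(x)=\sum_{k\ge0}(-1)^kk!\binom yk\binom xk\phi(x-k)$ and $\binom xk=x(x-1)\cdots(x-k+1)/k!$. The Teichmüller character $\omega_p(x)$ of a unit $x$ of $\mathbb{C}_p$ is the unique root of unity of order prime to $p$ with $|x-\omega_p(x)|<1$, and $\langle x\rangle_p=x/\omega_p(x)$; for $s\in\mathbb{Z}_p$, $\langle r\rangle_p^{s}=\sum_{k\ge0}\binom sk(\langle r\rangle_p-1)^k$. (At the archimedean place $\Psi_{r,\infty}(m)$ as defined agrees with the paper's archimedean function $r^s\Phi_{r,\infty}(\frac{s+1}{r}-1)$ for $r>0$, suitably modified for $r<0$, evaluated at $s=m$.) *)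

theory Defs
  imports "HOL-Analysis.Analysis" "HOL-Computational_Algebra.Computational_Algebra"
begin

text \<open>An element x of Z_p is represented by the sequence of its residues x n in [0, p^n),
  with x n = x (n+1) mod p^n.\<close>

type_synonym zp = "nat \<Rightarrow> int"

definition Zp :: "nat \<Rightarrow> zp set" where
  "Zp p = {x. \<forall>n. 0 \<le> x n \<and> x n < int p ^ n \<and> x n = x (Suc n) mod int p ^ n}"

definition zp_of_int :: "nat \<Rightarrow> int \<Rightarrow> zp" where
  "zp_of_int p k = (\<lambda>n. k mod int p ^ n)"

definition zp_add :: "nat \<Rightarrow> zp \<Rightarrow> zp \<Rightarrow> zp" where
  "zp_add p x y = (\<lambda>n. (x n + y n) mod int p ^ n)"

definition zp_sub :: "nat \<Rightarrow> zp \<Rightarrow> zp \<Rightarrow> zp" where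
  "zp_sub p x y = (\<lambda>n. (x n - y n) mod int p ^ n)"

definition zp_mul :: "nat \<Rightarrow> zp \<Rightarrow> zp \<Rightarrow> zp" where
  "zp_mul p x y = (\<lambda>n. (x n * y n) mod int p ^ n)"

primrec zp_pow :: "nat \<Rightarrow> zp \<Rightarrow> nat \<Rightarrow> zp" where
  "zp_pow p x 0 = zp_of_int p 1"
| "zp_pow p x (Suc k) = zp_mul p x (zp_pow p x k)"

primrec zp_sum :: "nat \<Rightarrow> (nat \<Rightarrow> zp) \<Rightarrow> nat \<Rightarrow> zp" where
  "zp_sum p a 0 = zp_of_int p 0"
| "zp_sum p a (Suc K) = zp_add p (zp_sum p a K) (a K)"

text \<open>x (an element of Z_p) equals the rational number c in Q_p, i.e. den(c) * x = num(c).\<close>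
definition zp_is_rat :: "nat \<Rightarrow> zp \<Rightarrow> rat \<Rightarrow> bool" where
  "zp_is_rat p x c = (case quotient_of c of (a, b) \<Rightarrow> \<forall>n. (x n * b - a) mod int p ^ n = 0)"

definition zp_of_rat :: "nat \<Rightarrow> rat \<Rightarrow> zp" where
  "zp_of_rat p c = (THE x. x \<in> Zp p \<and> zp_is_rat p x c)"

definition zp_inv :: "nat \<Rightarrow> zp \<Rightarrow> zp" where
  "zp_inv p x = (THE y. y \<in> Zp p \<and> zp_mul p x y = zp_of_int p 1)"

primrec zp_fallprod :: "nat \<Rightarrow> zp \<Rightarrow> nat \<Rightarrow> zp" where
  "zp_fallprod p s 0 = zp_of_int p 1"
| "zp_fallprod p s (Suc k) = zp_mul p (zp_fallprod p s k) (zp_sub p s (zp_of_int p (int k)))"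

definition zp_binom :: "nat \<Rightarrow> zp \<Rightarrow> nat \<Rightarrow> zp" where
  "zp_binom p s k = (THE y. y \<in> Zp p \<and> zp_mul p (zp_of_int p (fact k)) y = zp_fallprod p s k)"

definition zp_lim :: "nat \<Rightarrow> (nat \<Rightarrow> zp) \<Rightarrow> zp \<Rightarrow> bool" where
  "zp_lim p X x = (\<forall>N. \<exists>J. \<forall>j\<ge>J. X j N = x N)"

definition zp_suminf :: "nat \<Rightarrow> (nat \<Rightarrow> zp) \<Rightarrow> zp" where
  "zp_suminf p a = (THE s. s \<in> Zp p \<and> zp_lim p (zp_sum p a) s)"

definition zp_continuous :: "nat \<Rightarrow> (zp \<Rightarrow> zp) \<Rightarrow> bool" where
  "zp_continuous p f = (\<forall>x\<in>Zp p. \<forall>N. \<exists>M. \<forall>y\<in>Zp p. y M = x M \<longrightarrow> f y N = f x N)"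

definition f_r :: "rat \<Rightarrow> rat fps" where
  "f_r r = Abs_fps (\<lambda>k. if k = 0 then 0 else - r * (-1) ^ k * ((1 / r) gchoose k))"

definition phi_coeff :: "rat \<Rightarrow> nat \<Rightarrow> rat" where
  "phi_coeff r n = fact n * fps_nth (fps_exp 1 oo f_r r) n"

definition phi_rp :: "rat \<Rightarrow> nat \<Rightarrow> zp \<Rightarrow> zp" where
  "phi_rp r p = (THE f. (\<forall>x\<in>Zp p. f x \<in> Zp p) \<and> (\<forall>x. x \<notin> Zp p \<longrightarrow> f x = zp_of_int p 0)
      \<and> zp_continuous p f \<and> (\<forall>n. zp_is_rat p (f (zp_of_int p (int n))) (phi_coeff r n)))"

definition S_op :: "nat \<Rightarrow> zp \<Rightarrow> (zp \<Rightarrow> zp) \<Rightarrow> zp \<Rightarrow> zp" where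
  "S_op p y f x = zp_suminf p (\<lambda>k. zp_mul p (zp_of_int p ((-1) ^ k * fact k))
      (zp_mul p (zp_binom p y k) (zp_mul p (zp_binom p x k) (f (zp_sub p x (zp_of_int p (int k)))))))"

definition Phi_rp :: "rat \<Rightarrow> nat \<Rightarrow> zp \<Rightarrow> zp" where
  "Phi_rp r p s = S_op p s (phi_rp r p) (zp_of_int p (-1))"

definition teich :: "nat \<Rightarrow> zp \<Rightarrow> zp" where
  "teich p x = (THE w. w \<in> Zp p \<and> (\<exists>k>0. \<not> p dvd k \<and> zp_pow p w k = zp_of_int p 1) \<and> w 1 = x 1)"

definition bracket :: "nat \<Rightarrow> zp \<Rightarrow> zp" where
  "bracket p x = zp_mul p x (zp_inv p (teich p x))"

definition bracket_pow :: "nat \<Rightarrow> zp \<Rightarrow> zp \<Rightarrow> zp" where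
  "bracket_pow p x s = zp_suminf p (\<lambda>k. zp_mul p (zp_binom p s k)
      (zp_pow p (zp_sub p (bracket p x) (zp_of_int p 1)) k))"

definition Psi_rp :: "rat \<Rightarrow> nat \<Rightarrow> zp \<Rightarrow> zp" where
  "Psi_rp r p s = zp_mul p (bracket_pow p (zp_of_rat p r) s)
      (Phi_rp r p (zp_sub p (zp_mul p (zp_add p s (zp_of_int p 1)) (zp_of_rat p (inverse r)))
                            (zp_of_int p 1)))"

definition Psi_inf :: "rat \<Rightarrow> nat \<Rightarrow> real" where
  "Psi_inf r m = exp (real_of_rat r) * integral {real_of_rat r..} (\<lambda>u. u ^ m * exp (- u))"

definition P_r :: "rat \<Rightarrow> nat set" where
  "P_r r = {p. prime p \<and> multiplicity (int p) (fst (quotient_of r)) \<noteq> multiplicity (int p) (snd (quotient_of r))}"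

datatype place = PrimePlace nat | InfPlace

definition admissible :: "rat \<Rightarrow> place \<Rightarrow> bool" where
  "admissible r v = (case v of PrimePlace p \<Rightarrow> prime p \<and> p \<notin> P_r r | InfPlace \<Rightarrow> True)"

definition ell :: "place \<Rightarrow> nat" where
  "ell v = (case v of PrimePlace p \<Rightarrow> p - 1 | InfPlace \<Rightarrow> 1)"

definition Psi_is_rat :: "rat \<Rightarrow> place \<Rightarrow> nat \<Rightarrow> rat \<Rightarrow> bool" where
  "Psi_is_rat r v m c = (case v of
     PrimePlace p \<Rightarrow> zp_is_rat p (Psi_rp r p (zp_of_int p (int m))) c
   | InfPlace \<Rightarrow> Psi_inf r m = real_of_rat c)"

definition normPsi_is_rat :: "rat \<Rightarrow> place \<Rightarrow> nat \<Rightarrow> rat \<Rightarrow> bool" where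
  "normPsi_is_rat r v m c = (case v of
     PrimePlace p \<Rightarrow> zp_is_rat p (zp_mul p (bracket_pow p (zp_of_rat p r) (zp_of_int p (- int m)))
                                         (Psi_rp r p (zp_of_int p (int m)))) c
   | InfPlace \<Rightarrow> real_of_rat r powi (- int m) * Psi_inf r m = real_of_rat c)"

end

theory Submission
  imports Defs "HOL-Number_Theory.Residues"
begin

text \<open>Put \<open>G = exp (f_r)\<close>. Since \<open>f_r = r - r (1 - t)^(1/r)\<close>, one has \<open>G' = (1 - t)^(1/r - 1) G\<close>, and the
  operator \<open>S^s\<close> multiplies the exponential generating function of \<open>\<phi>\<close> by \<open>(1 - t)^s\<close>. With
  \<open>s_m = (m + 1)/r - 1\<close>, the derivative of \<open>(1 - t)^(m/r) G\<close> is
  \<open>- (m/r) (1 - t)^(s_(m-1)) G + (1 - t)^(s_m) G\<close>. Reading off the coefficient of index \<open>n\<close> and letting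
  \<open>n \<rightarrow> -1\<close> \<open>p\<close>-adically (\<open>n = p^M - 1\<close>) gives \<open>\<Phi>(s_m) = (m/r) \<Phi>(s_(m-1)) + 1\<close>. Integration by parts
  yields the same recursion for \<open>r^(-m) e^r \<integral> u^m e^(-u) du\<close>. The continuity of \<open>\<phi>\<close> comes from
  Mahler's expansion: its coefficients \<open>k! [t^k] exp (f_r - t)\<close> are divisible by \<open>(k div 2)!\<close>, because
  \<open>f_r - t\<close> is a \<open>p\<close>-integral power series divisible by \<open>t^2\<close>.\<close>

section \<open>Rational numbers in the ring of p-adic integers\<close>

text \<open>The values to be compared are rationals with denominator prime to \<open>p\<close>.
  Limits in the p-adic integers are therefore replaced by congruences modulo \<open>p ^ N\<close>
  between rationals (\<open>loc_cong\<close>), and \<open>zp_emb\<close> carries the result back to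
  residue sequences. The objects are definite descriptions, so each is usable only once existence
  and uniqueness are established. Two facts about factorials shape the estimates. A binomial
  coefficient divides by \<open>k!\<close>, so continuity in its upper argument costs digits of
  precision; on the other hand \<open>k!\<close> tends to 0, which makes the series for
  \<open>S^s\<close> converge and lets it be truncated uniformly. The choice
  \<open>n = p^M - 1\<close> is made because differentiation raises the index to \<open>p^M\<close>,
  which tends to 0, and there the transformed function equals \<open>phi(0) = 1\<close>: this is the
  summand 1 of the recursion. The two parts then differ only in the factor at a prime: the powers of
  \<open><r>\<close> with exponents \<open>m\<close> and \<open>-m\<close> cancel for every
  \<open>m\<close>, whereas \<open><r>^m = r^m\<close> relies on the Teichmueller factor being a
  root of unity of order dividing \<open>p - 1\<close>.\<close>

definition Zloc :: "nat \<Rightarrow> rat set" where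
  "Zloc p = {of_int a / of_int b | a b. \<not> int p dvd b}"

text \<open>Neither side has to lie in \<open>Zloc p\<close>. For \<open>n = 0\<close> the relation
  says only that the difference is p-integral, which is how integrality gets transferred from one
  side to the other.\<close>

definition loc_cong :: "nat \<Rightarrow> nat \<Rightarrow> rat \<Rightarrow> rat \<Rightarrow> bool" where
  "loc_cong p n x y \<longleftrightarrow> (\<exists>z\<in>Zloc p. x - y = of_nat p ^ n * z)"

text \<open>The canonical map from the localization of the integers at \<open>p\<close> to the
  p-adic integers. The choice of \<open>u\<close> is harmless: two candidates agree modulo
  \<open>p ^ n\<close>, and the residue is reduced.\<close>

definition zp_emb :: "nat \<Rightarrow> rat \<Rightarrow> zp" where
  "zp_emb p c = (\<lambda>n. (SOME u. loc_cong p n c (of_int u)) mod int p ^ n)"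

context
  fixes p :: nat
  assumes p: "prime p"
begin

lemma not_dvd_mult: "\<not> int p dvd a \<Longrightarrow> \<not> int p dvd b \<Longrightarrow> \<not> int p dvd a * b"
  using p by (simp add: prime_dvd_mult_iff)

lemma Zloc_of_int [simp, intro]: "of_int a \<in> Zloc p"
proof -
  have "\<not> int p dvd 1" using p by (auto dest: prime_gt_1_nat)
  then show ?thesis unfolding Zloc_def by (intro CollectI exI[of _ a] exI[of _ 1]) simp
qed

lemma Zloc_0 [simp, intro]: "0 \<in> Zloc p" using Zloc_of_int[of 0] by simp
lemma Zloc_1 [simp, intro]: "1 \<in> Zloc p" using Zloc_of_int[of 1] by simp
lemma Zloc_of_nat [simp, intro]: "of_nat a \<in> Zloc p" using Zloc_of_int[of "int a"] by simp

lemma Zloc_add [intro]: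
  assumes "x \<in> Zloc p" "y \<in> Zloc p" shows "x + y \<in> Zloc p"
proof -
  obtain a b c d where "x = of_int a / of_int b" "\<not> int p dvd b" "y = of_int c / of_int d" "\<not> int p dvd d"
    using assms unfolding Zloc_def by blast
  moreover from this have "b \<noteq> 0" "d \<noteq> 0" by auto
  ultimately have "x + y = of_int (a * d + c * b) / of_int (b * d)" "\<not> int p dvd b * d"
    using not_dvd_mult by (auto simp: field_simps)
  then show ?thesis unfolding Zloc_def by blast
qed

lemma Zloc_mult [intro]:
  assumes "x \<in> Zloc p" "y \<in> Zloc p" shows "x * y \<in> Zloc p"
proof -
  obtain a b c d where "x = of_int a / of_int b" "\<not> int p dvd b" "y = of_int c / of_int d" "\<not> int p dvd d"
    using assms unfolding Zloc_def by blast
  then have "x * y = of_int (a * c) / of_int (b * d)" "\<not> int p dvd b * d"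
    using not_dvd_mult by auto
  then show ?thesis unfolding Zloc_def by blast
qed

lemma Zloc_minus [intro]: "x \<in> Zloc p \<Longrightarrow> - x \<in> Zloc p"
  using Zloc_mult[of "- 1" x] Zloc_of_int[of "- 1"] by simp

lemma Zloc_diff [intro]: "x \<in> Zloc p \<Longrightarrow> y \<in> Zloc p \<Longrightarrow> x - y \<in> Zloc p"
  using Zloc_add[of x "- y"] Zloc_minus[of y] by simp

lemma Zloc_power [intro]: "x \<in> Zloc p \<Longrightarrow> x ^ n \<in> Zloc p"
  by (induction n) auto

lemma Zloc_sum [intro]: "(\<And>i. i \<in> I \<Longrightarrow> f i \<in> Zloc p) \<Longrightarrow> sum f I \<in> Zloc p"
  by (induction I rule: infinite_finite_induct) auto

lemma loc_cong_refl [simp, intro]: "loc_cong p n x x"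
  unfolding loc_cong_def by (auto intro: bexI[of _ 0])

lemma loc_cong_sym: "loc_cong p n x y \<Longrightarrow> loc_cong p n y x"
  unfolding loc_cong_def by (metis Zloc_minus minus_diff_eq mult_minus_right)

lemma loc_cong_add:
  assumes "loc_cong p n x y" "loc_cong p n x' y'" shows "loc_cong p n (x + x') (y + y')"
proof -
  obtain z z' where "z \<in> Zloc p" "z' \<in> Zloc p" "x - y = of_nat p ^ n * z" "x' - y' = of_nat p ^ n * z'"
    using assms unfolding loc_cong_def by blast
  then show ?thesis unfolding loc_cong_def
    by (intro bexI[of _ "z + z'"]) (auto simp: algebra_simps)
qed

lemma loc_cong_trans [trans]: "loc_cong p n x y \<Longrightarrow> loc_cong p n y z \<Longrightarrow> loc_cong p n x z"
  using loc_cong_add[of n x y y z] by (simp add: loc_cong_def algebra_simps)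

lemma loc_cong_mult_left:
  assumes "c \<in> Zloc p" "loc_cong p n x y" shows "loc_cong p n (c * x) (c * y)"
proof -
  obtain z where z: "z \<in> Zloc p" "x - y = of_nat p ^ n * z" using assms unfolding loc_cong_def by blast
  have "c * x - c * y = c * (x - y)" by (simp add: algebra_simps)
  also have "\<dots> = of_nat p ^ n * (c * z)" using z by simp
  finally show ?thesis unfolding loc_cong_def using z assms by blast
qed

lemma loc_cong_mult_right:
  "c \<in> Zloc p \<Longrightarrow> loc_cong p n x y \<Longrightarrow> loc_cong p n (x * c) (y * c)"
  using loc_cong_mult_left by (simp add: mult.commute)

lemma loc_cong_mult:
  assumes "loc_cong p n x y" "loc_cong p n x' y'" "y \<in> Zloc p" "x' \<in> Zloc p"
  shows "loc_cong p n (x * x') (y * y')"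
  using loc_cong_trans[OF loc_cong_mult_right[OF assms(4,1)] loc_cong_mult_left[OF assms(3,2)]] .

lemma loc_cong_minus: "loc_cong p n x y \<Longrightarrow> loc_cong p n (- x) (- y)"
  using loc_cong_mult_left[of "- 1" n x y] Zloc_of_int[of "- 1"] by simp

lemma loc_cong_diff: "loc_cong p n x y \<Longrightarrow> loc_cong p n x' y' \<Longrightarrow> loc_cong p n (x - x') (y - y')"
  using loc_cong_add[of n x y "- x'" "- y'"] loc_cong_minus[of n x' y'] by simp

lemma loc_cong_sum:
  "(\<And>i. i \<in> I \<Longrightarrow> loc_cong p n (f i) (g i)) \<Longrightarrow> loc_cong p n (sum f I) (sum g I)"
  by (induction I rule: infinite_finite_induct) (auto intro: loc_cong_add)

lemma loc_cong_Zloc: "loc_cong p n x y \<Longrightarrow> y \<in> Zloc p \<Longrightarrow> x \<in> Zloc p"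
  unfolding loc_cong_def
  by (metis Zloc_add Zloc_mult Zloc_of_nat Zloc_power add_diff_cancel diff_add_cancel)

lemma loc_cong_mono:
  assumes "loc_cong p n x y" "m \<le> n" shows "loc_cong p m x y"
proof -
  obtain z where z: "z \<in> Zloc p" "x - y = of_nat p ^ n * z" using assms unfolding loc_cong_def by blast
  have "x - y = of_nat p ^ m * (of_nat p ^ (n - m) * z)"
    using z assms(2) by (simp flip: power_add mult.assoc)
  then show ?thesis unfolding loc_cong_def using z by blast
qed

lemma loc_cong_0_iff: "loc_cong p n x 0 \<longleftrightarrow> (\<exists>z\<in>Zloc p. x = of_nat p ^ n * z)"
  by (simp add: loc_cong_def)

lemma loc_cong_of_int_iff: "loc_cong p n (of_int a) (of_int b) \<longleftrightarrow> [a = b] (mod int p ^ n)"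
proof
  assume "loc_cong p n (of_int a) (of_int b)"
  then obtain c d where cd: "\<not> int p dvd d" "of_int a - of_int b = of_nat p ^ n * (of_int c / of_int d :: rat)"
    unfolding loc_cong_def Zloc_def by blast
  then have "d \<noteq> 0" by auto
  then have "of_int ((a - b) * d) = (of_int (int p ^ n * c) :: rat)"
    using cd(2) by (simp add: field_simps)
  then have "(a - b) * d = int p ^ n * c" by (simp only: of_int_eq_iff)
  then have "int p ^ n dvd (a - b) * d" by simp
  moreover have "coprime (int p ^ n) d"
    using p cd(1) by (simp add: prime_imp_coprime)
  ultimately have "int p ^ n dvd a - b" by (simp add: coprime_dvd_mult_left_iff)
  then show "[a = b] (mod int p ^ n)" by (simp add: cong_iff_dvd_diff)
next
  assume "[a = b] (mod int p ^ n)"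
  then obtain k where "a - b = int p ^ n * k" by (auto simp: cong_iff_dvd_diff)
  then have "of_int a - of_int b = (of_nat p ^ n * of_int k :: rat)"
    by (metis of_int_diff of_int_mult of_int_of_nat_eq of_int_power)
  then show "loc_cong p n (of_int a) (of_int b)" unfolding loc_cong_def by blast
qed

lemma Zloc_approx:
  assumes "x \<in> Zloc p" shows "\<exists>u::int. loc_cong p n x (of_int u)"
proof -
  obtain a b where ab: "x = of_int a / of_int b" "\<not> int p dvd b" using assms unfolding Zloc_def by blast
  then have b0: "b \<noteq> 0" by auto
  have "coprime (int p) b" using p ab(2) by (simp add: prime_imp_coprime)
  then have "coprime b (int p ^ n)" by (simp add: coprime_commute)
  then obtain b' where "[b * b' = 1] (mod int p ^ n)" using cong_solve_coprime_int by blast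
  then obtain k where "b * b' - 1 = int p ^ n * k" by (auto simp: cong_iff_dvd_diff)
  then have k: "of_int b * of_int b' - 1 = (of_nat p ^ n * of_int k :: rat)"
    by (metis of_int_diff of_int_mult of_int_of_nat_eq of_int_power of_int_1)
  have "x - of_int (a * b') = - (of_int a / of_int b) * (of_int b * of_int b' - 1)"
    using b0 ab by (simp add: field_simps)
  also have "\<dots> = of_nat p ^ n * (- x * of_int k)" unfolding k ab(1) by simp
  finally show ?thesis unfolding loc_cong_def using assms
    by (metis Zloc_minus Zloc_mult Zloc_of_int)
qed

lemma Zloc_approx_nat:
  assumes "x \<in> Zloc p" shows "\<exists>u::nat. loc_cong p n x (of_nat u)"
proof -
  obtain u :: int where u: "loc_cong p n x (of_int u)" using Zloc_approx[OF assms] by blast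
  have "loc_cong p n (of_int u) (of_int (u mod int p ^ n))" by (simp add: loc_cong_of_int_iff cong_def)
  moreover have "0 \<le> u mod int p ^ n" using p by (simp add: prime_gt_0_nat)
  ultimately show ?thesis using u loc_cong_trans
    by (metis of_int_of_nat_eq int_nat_eq)
qed

section \<open>Arithmetic of residue sequences and its compatibility with the embedding\<close>

lemma ZpD: assumes "x \<in> Zp p" shows "0 \<le> x n" "x n < int p ^ n" "x n mod int p ^ n = x n"
proof -
  show *: "0 \<le> x n" "x n < int p ^ n" using assms unfolding Zp_def by blast+
  then show "x n mod int p ^ n = x n" by simp
qed

lemma Zp_mono: assumes "x \<in> Zp p" "m \<le> n" shows "x n mod int p ^ m = x m"
  using assms(2)
proof (induction n rule: dec_induct)
  case base then show ?case using ZpD(3)[OF assms(1)] .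
next
  case (step n)
  have "x n = x (Suc n) mod int p ^ n" using assms(1) unfolding Zp_def by blast
  then have "x m = x (Suc n) mod int p ^ n mod int p ^ m" using step by simp
  then show ?case using step(1) by (simp add: mod_mod_cancel le_imp_power_dvd)
qed

lemma ZpI:
  assumes "\<And>n. x n = y n mod int p ^ n" "\<And>n. [y (Suc n) = y n] (mod int p ^ n)"
  shows "x \<in> Zp p"
  unfolding Zp_def
proof (intro CollectI allI conjI)
  fix n
  have pos: "int p ^ n > 0" using p by (simp add: prime_gt_0_nat)
  show "0 \<le> x n" "x n < int p ^ n" using pos by (simp_all add: assms(1))
  have "y (Suc n) mod int p ^ Suc n mod int p ^ n = y n mod int p ^ n"
    using assms(2)[of n] by (simp only: cong_def mod_mod_cancel[OF le_imp_power_dvd[OF le_SucI[OF order_refl]]])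
  then show "x n = x (Suc n) mod int p ^ n" using assms(1) by metis
qed

lemma Zp_cong: assumes "x \<in> Zp p" shows "[x (Suc n) = x n] (mod int p ^ n)"
  using Zp_mono[OF assms, of n "Suc n"] ZpD(3)[OF assms] by (simp add: cong_def)

lemma Zp_eqI:
  assumes "x \<in> Zp p" "y \<in> Zp p" "\<And>n. [x n = y n] (mod int p ^ n)" shows "x = y"
  using assms ZpD(3) by (metis cong_def ext)

lemma zp_of_int_Zp [simp, intro]: "zp_of_int p k \<in> Zp p"
  by (rule ZpI[of _ "\<lambda>_. k"]) (auto simp: zp_of_int_def)

lemma zp_add_Zp [simp, intro]: "x \<in> Zp p \<Longrightarrow> y \<in> Zp p \<Longrightarrow> zp_add p x y \<in> Zp p"
  by (rule ZpI[where y = "\<lambda>n. x n + y n"]) (simp_all add: zp_add_def cong_add Zp_cong)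

lemma zp_sub_Zp [simp, intro]: "x \<in> Zp p \<Longrightarrow> y \<in> Zp p \<Longrightarrow> zp_sub p x y \<in> Zp p"
  by (rule ZpI[where y = "\<lambda>n. x n - y n"]) (simp_all add: zp_sub_def cong_diff Zp_cong)

lemma zp_mul_Zp [simp, intro]: "x \<in> Zp p \<Longrightarrow> y \<in> Zp p \<Longrightarrow> zp_mul p x y \<in> Zp p"
  by (rule ZpI[where y = "\<lambda>n. x n * y n"]) (simp_all add: zp_mul_def cong_mult Zp_cong)

lemma zp_pow_Zp [simp, intro]: "x \<in> Zp p \<Longrightarrow> zp_pow p x k \<in> Zp p"
  by (induction k) auto

lemma zp_sum_Zp [simp, intro]: "(\<And>k. a k \<in> Zp p) \<Longrightarrow> zp_sum p a K \<in> Zp p"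
  by (induction K) auto

lemma zp_pow_cong: "[zp_pow p x k n = x n ^ k] (mod int p ^ n)"
  by (induction k) (auto simp: zp_of_int_def zp_mul_def cong_def mod_mult_right_eq intro: mod_mult_cong)

lemma zp_sum_cong: "[zp_sum p a K n = (\<Sum>k<K. a k n)] (mod int p ^ n)"
  by (induction K) (auto simp: zp_of_int_def zp_add_def cong_def intro: mod_add_cong)

lemma zp_emb_loc_cong:
  assumes "c \<in> Zloc p" shows "loc_cong p n (of_int (zp_emb p c n)) c"
proof -
  have "loc_cong p n c (of_int (SOME u. loc_cong p n c (of_int u)))"
    using Zloc_approx[OF assms] by (rule someI_ex)
  moreover have "loc_cong p n (of_int (u mod int p ^ n)) (of_int u)" for u
    by (simp add: loc_cong_of_int_iff cong_def)
  ultimately show ?thesis unfolding zp_emb_def by (meson loc_cong_sym loc_cong_trans)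
qed

lemma zp_emb_Zp [simp, intro]:
  assumes "c \<in> Zloc p" shows "zp_emb p c \<in> Zp p"
proof (rule ZpI)
  show "zp_emb p c n = zp_emb p c n mod int p ^ n" for n by (simp add: zp_emb_def)
  show "[zp_emb p c (Suc n) = zp_emb p c n] (mod int p ^ n)" for n
    unfolding loc_cong_of_int_iff[symmetric]
    using zp_emb_loc_cong[OF assms] loc_cong_mono[OF zp_emb_loc_cong[OF assms]] loc_cong_trans loc_cong_sym
    by (meson le_SucI order_refl)
qed

lemma zp_embI:
  assumes "x \<in> Zp p" "c \<in> Zloc p" "\<And>n. loc_cong p n (of_int (x n)) c"
  shows "x = zp_emb p c"
proof (rule Zp_eqI)
  show "[x n = zp_emb p c n] (mod int p ^ n)" for n
    unfolding loc_cong_of_int_iff[symmetric] using zp_emb_loc_cong[OF assms(2)] assms(3) loc_cong_trans loc_cong_sym by meson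
qed (use assms in auto)

lemma loc_cong_mod: "loc_cong p n (of_int (u mod int p ^ n)) (of_int u)"
  by (simp add: loc_cong_of_int_iff cong_def)

lemma loc_cong_zp_mul:
  assumes "loc_cong p N (of_int (x N)) c" "loc_cong p N (of_int (y N)) d" "c \<in> Zloc p"
  shows "loc_cong p N (of_int (zp_mul p x y N)) (c * d)"
  using loc_cong_trans[OF loc_cong_mod, of N "x N * y N"] loc_cong_mult[OF assms Zloc_of_int]
  by (simp add: zp_mul_def)

lemma zp_of_int_emb: "zp_of_int p k = zp_emb p (of_int k)"
proof (rule zp_embI)
  show "loc_cong p n (of_int (zp_of_int p k n)) (of_int k)" for n
    by (simp add: zp_of_int_def loc_cong_mod)
qed auto

lemma zp_add_emb: "a \<in> Zloc p \<Longrightarrow> b \<in> Zloc p \<Longrightarrow> zp_add p (zp_emb p a) (zp_emb p b) = zp_emb p (a + b)"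
  proof (rule zp_embI)
  assume "a \<in> Zloc p" "b \<in> Zloc p"
  then show "loc_cong p n (of_int (zp_add p (zp_emb p a) (zp_emb p b) n)) (a + b)" for n
    by (auto simp: zp_add_def intro!: loc_cong_trans[OF loc_cong_mod] loc_cong_add zp_emb_loc_cong)
qed auto

lemma zp_sub_emb: "a \<in> Zloc p \<Longrightarrow> b \<in> Zloc p \<Longrightarrow> zp_sub p (zp_emb p a) (zp_emb p b) = zp_emb p (a - b)"
  proof (rule zp_embI)
  assume "a \<in> Zloc p" "b \<in> Zloc p"
  then show "loc_cong p n (of_int (zp_sub p (zp_emb p a) (zp_emb p b) n)) (a - b)" for n
    by (auto simp: zp_sub_def intro!: loc_cong_trans[OF loc_cong_mod] loc_cong_diff zp_emb_loc_cong)
qed auto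

lemma zp_mul_emb: "a \<in> Zloc p \<Longrightarrow> b \<in> Zloc p \<Longrightarrow> zp_mul p (zp_emb p a) (zp_emb p b) = zp_emb p (a * b)"
  proof (rule zp_embI)
  assume "a \<in> Zloc p" "b \<in> Zloc p"
  then show "loc_cong p n (of_int (zp_mul p (zp_emb p a) (zp_emb p b) n)) (a * b)" for n
    by (auto simp: zp_mul_def intro!: loc_cong_trans[OF loc_cong_mod] loc_cong_mult zp_emb_loc_cong)
qed auto

text \<open>The reduced denominator of \<open>c\<close> divides any other denominator, in particular
  one prime to \<open>p\<close>. It is thus invertible in \<open>Zloc p\<close> and can be cancelled
  from the defining equation.\<close>

lemma zp_is_rat_iff:
  assumes "c \<in> Zloc p" "x \<in> Zp p"
  shows "zp_is_rat p x c \<longleftrightarrow> x = zp_emb p c"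
proof -
  obtain a b where q: "quotient_of c = (a, b)" by fastforce
  have b0: "b > 0" "coprime a b" "c = of_int a / of_int b"
    using q quotient_of_denom_pos quotient_of_coprime quotient_of_div by auto
  obtain a' b' where c: "c = of_int a' / of_int b'" "\<not> int p dvd b'"
    using assms(1) unfolding Zloc_def by blast
  have "b' \<noteq> 0" using c by auto
  then have "of_int (a * b') = (of_int (a' * b) :: rat)" using c b0 by (simp add: field_simps)
  then have "a * b' = a' * b" by (simp only: of_int_eq_iff)
  then have "b dvd a * b'" by simp
  then have "b dvd b'" using b0(2) by (simp add: coprime_dvd_mult_right_iff coprime_commute)
  then have nb: "\<not> int p dvd b" using c(2) dvd_trans by blast
  have binv: "1 / of_int b \<in> Zloc p" unfolding Zloc_def using nb by (intro CollectI exI[of _ 1] exI[of _ b]) simp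
  have "(x n * b - a) mod int p ^ n = 0 \<longleftrightarrow> loc_cong p n (of_int (x n)) c" for n
  proof -
    have "(x n * b - a) mod int p ^ n = 0 \<longleftrightarrow> loc_cong p n (of_int (x n * b)) (of_int a)"
      unfolding loc_cong_of_int_iff by (simp add: cong_iff_dvd_diff dvd_eq_mod_eq_0)
    also have "\<dots> \<longleftrightarrow> loc_cong p n (of_int (x n)) c"
      using loc_cong_mult_left[OF binv, of n "of_int (x n * b)" "of_int a"]
        loc_cong_mult_left[of "of_int b" n "of_int (x n)" c] b0 by (auto simp: mult.commute)
    finally show ?thesis .
  qed
  then have "zp_is_rat p x c \<longleftrightarrow> (\<forall>n. loc_cong p n (of_int (x n)) c)" by (simp add: zp_is_rat_def q)
  then show ?thesis using zp_embI[OF assms(2,1)] zp_emb_loc_cong[OF assms(1)] by metis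
qed

lemma zp_of_rat_emb: "c \<in> Zloc p \<Longrightarrow> zp_of_rat p c = zp_emb p c"
  unfolding zp_of_rat_def
  by (rule the_equality) (auto simp: zp_is_rat_iff)

text \<open>Residues are reduced, so a term that is small p-adically has residue exactly 0. At each
  level the series is then a finite sum and the partial sums become stationary.\<close>

lemma zp_suminf_eq:
  assumes "\<And>k. a k \<in> Zp p" "\<And>N. \<exists>J. \<forall>k\<ge>J. a k N = 0"
  shows "zp_suminf p a \<in> Zp p" "\<And>N. \<exists>J. \<forall>K\<ge>J. [zp_suminf p a N = (\<Sum>k<K. a k N)] (mod int p ^ N)"
proof -
  obtain J where J: "\<And>N k. k \<ge> J N \<Longrightarrow> a k N = 0" using assms(2) by metis
  have eq: "(\<Sum>k<K. a k N) = (\<Sum>k<J N. a k N)" if "K \<ge> J N" for K N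
    by (rule sum.mono_neutral_right) (use that J in auto)
  have zeq: "zp_sum p a K N = (\<Sum>k<J N. a k N) mod int p ^ N" if "K \<ge> J N" for K N
    using zp_sum_cong[of a K N] ZpD(3)[OF zp_sum_Zp[of a K]] assms(1) eq[OF that]
    by (simp add: cong_def)
  define s where "s N = (\<Sum>k<J N. a k N) mod int p ^ N" for N
  have sS: "s \<in> Zp p"
  proof (rule ZpI)
    show "s n = (\<Sum>k<J n. a k n) mod int p ^ n" for n by (simp add: s_def)
    show "[(\<Sum>k<J (Suc n). a k (Suc n)) = (\<Sum>k<J n. a k n)] (mod int p ^ n)" for n
    proof -
      let ?K = "max (J n) (J (Suc n))"
      have "[(\<Sum>k<?K. a k (Suc n)) = (\<Sum>k<?K. a k n)] (mod int p ^ n)"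
        by (intro cong_sum Zp_cong assms)
      then show ?thesis using eq[of n ?K] eq[of "Suc n" ?K] by simp
    qed
  qed
  have lim: "zp_lim p (zp_sum p a) s" unfolding zp_lim_def s_def using zeq by blast
  have "zp_suminf p a = s" unfolding zp_suminf_def
  proof (rule the_equality)
    show "s \<in> Zp p \<and> zp_lim p (zp_sum p a) s" using lim sS by simp
    fix t assume t: "t \<in> Zp p \<and> zp_lim p (zp_sum p a) t"
    show "t = s"
    proof
      fix N
      obtain J1 J2 where "\<forall>j\<ge>J1. zp_sum p a j N = t N" "\<forall>j\<ge>J2. zp_sum p a j N = s N"
        using t lim unfolding zp_lim_def by meson
      then show "t N = s N" by (metis max.cobounded1 max.cobounded2)
    qed
  qed
  moreover have "\<exists>J. \<forall>K\<ge>J. [s N = (\<Sum>k<K. a k N)] (mod int p ^ N)" for N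
    by (rule exI[of _ "J N"]) (metis s_def eq cong_mod_left cong_refl)
  ultimately show "zp_suminf p a \<in> Zp p"
      "\<And>N. \<exists>J. \<forall>K\<ge>J. [zp_suminf p a N = (\<Sum>k<K. a k N)] (mod int p ^ N)"
    using sS by simp_all
qed

end

section \<open>Binomial coefficients and the generating function\<close>

lemma fact_gbinomial: "fact k * ((s::rat) gchoose k) = (\<Prod>i<k. s - of_nat i)"
  by (simp add: gbinomial_prod_rev atLeast0LessThan)

context
  fixes p :: nat
  assumes p: "prime p"
begin

lemma Zloc_inverse_of_nat:
  assumes "\<not> p dvd u" shows "1 / of_nat u \<in> Zloc p"
  unfolding Zloc_def using assms by (intro CollectI exI[of _ 1] exI[of _ "int u"]) simp

lemma fact_p_decomp: obtains V u where "fact L = p ^ V * u" "\<not> p dvd u"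
proof -
  have "(fact L :: nat) \<noteq> 0" "\<not> is_unit p" using p by (auto dest: prime_gt_1_nat)
  then show ?thesis using multiplicity_decompose'[of "fact L" p] that by blast
qed

text \<open>Cancelling a factor with p-part \<open>p ^ V\<close> costs \<open>V\<close> digits; the
  remaining factor \<open>u\<close> is a unit.\<close>

lemma loc_cong_cancel:
  assumes "\<not> p dvd u" "loc_cong p (N + V) (of_nat (p ^ V * u) * x) (of_nat (p ^ V * u) * y)"
  shows "loc_cong p N x y"
proof -
  obtain z where z: "z \<in> Zloc p" "of_nat (p ^ V * u) * x - of_nat (p ^ V * u) * y = of_nat p ^ (N + V) * z"
    using assms(2) unfolding loc_cong_def by blast
  have "of_nat p \<noteq> (0::rat)" "of_nat u \<noteq> (0::rat)" using p assms(1) by (auto intro!: Nat.gr0I dest: prime_gt_0_nat)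
  moreover have "(x - y) * of_nat u * of_nat p ^ V = (of_nat p ^ N * z) * of_nat p ^ V"
    using z(2) by (simp add: algebra_simps power_add)
  ultimately have "(x - y) * of_nat u = of_nat p ^ N * z" by simp
  with \<open>of_nat u \<noteq> (0::rat)\<close> have "x - y = of_nat p ^ N * (1 / of_nat u * z)"
    by (simp add: field_simps)
  then show ?thesis unfolding loc_cong_def using Zloc_mult[OF p Zloc_inverse_of_nat[OF assms(1)] z(1)] by blast
qed

text \<open>Falling products are polynomials with integer coefficients, so they preserve congruences
  without loss. This is used wherever \<open>k!\<close> can be kept next to the binomial
  coefficient.\<close>

lemma loc_cong_falling:
  assumes "loc_cong p N s s'" "s \<in> Zloc p" "s' \<in> Zloc p"
  shows "loc_cong p N (\<Prod>i<k. s - of_nat i) (\<Prod>i<k. s' - of_nat i)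
    \<and> (\<Prod>i<k. s - of_nat i) \<in> Zloc p \<and> (\<Prod>i<k. s' - of_nat i) \<in> Zloc p"
proof (induction k)
  case (Suc k)
  have "s - of_nat k \<in> Zloc p" "s' - of_nat k \<in> Zloc p" using assms p by blast+
  moreover have "loc_cong p N (s - of_nat k) (s' - of_nat k)"
    using assms(1) p by (intro loc_cong_diff loc_cong_refl)
  ultimately show ?case using Suc p by (auto intro!: loc_cong_mult Zloc_mult)
qed (use p in auto)

text \<open>Uniform continuity of the first binomial polynomials. The modulus is
  \<open>N + V\<close>, with \<open>V\<close> the exponent of \<open>p\<close> in \<open>L!\<close>:
  multiplied by \<open>L!\<close>, each of them becomes an integer multiple of a falling
  product.\<close>

lemma gbinomial_loc_cong:
  "\<exists>M. \<forall>k\<le>L. \<forall>s\<in>Zloc p. \<forall>s'\<in>Zloc p. loc_cong p M s s' \<longrightarrow> loc_cong p N (s gchoose k) (s' gchoose k)"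
proof -
  obtain V u where V: "fact L = p ^ V * u" "\<not> p dvd u" using fact_p_decomp by blast
  show ?thesis
  proof (intro exI[of _ "N + V"] allI ballI impI)
    fix k s s' assume k: "k \<le> L" and s: "s \<in> Zloc p" "s' \<in> Zloc p" "loc_cong p (N + V) s s'"
    obtain q where q: "(fact L :: nat) = fact k * q" using fact_dvd[OF k] by (auto elim: dvdE)
    have eq: "of_nat (p ^ V * u) * (t gchoose k) = of_nat q * (\<Prod>i<k. t - of_nat i)" for t :: rat
      unfolding V(1)[symmetric] q fact_gbinomial[symmetric] by simp
    have "loc_cong p (N + V) (of_nat (p ^ V * u) * (s gchoose k)) (of_nat (p ^ V * u) * (s' gchoose k))"
      unfolding eq using loc_cong_falling[OF s(3,1,2)] p by (intro loc_cong_mult_left) auto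
    then show "loc_cong p N (s gchoose k) (s' gchoose k)" by (rule loc_cong_cancel[OF V(2)])
  qed
qed

text \<open>Natural numbers are dense in \<open>Zloc p\<close> and have integer binomial
  coefficients; continuity at precision \<open>N = 0\<close> carries over just the
  integrality.\<close>

lemma gbinomial_Zloc [intro]:
  assumes "s \<in> Zloc p" shows "(s gchoose k) \<in> Zloc p"
proof -
  obtain M where "\<forall>s'\<in>Zloc p. loc_cong p M s s' \<longrightarrow> loc_cong p 0 (s gchoose k) (s' gchoose k)"
    using gbinomial_loc_cong[of k 0] assms by auto
  moreover obtain n where "loc_cong p M s (of_nat n)" using Zloc_approx_nat[OF p assms] by blast
  ultimately have "loc_cong p 0 (s gchoose k) (of_nat (n choose k))"
    using p by (simp add: binomial_gbinomial)
  then show ?thesis using loc_cong_Zloc p by blast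
qed

lemma zp_fallprod_emb:
  assumes "s \<in> Zloc p"
  shows "zp_fallprod p (zp_emb p s) k = zp_emb p (\<Prod>i<k. s - of_nat i)"
proof (induction k)
  case 0 then show ?case using p by (simp add: zp_of_int_emb)
next
  case (Suc k)
  have "(\<Prod>i<k. s - of_nat i) \<in> Zloc p" "s - of_nat k \<in> Zloc p"
    using loc_cong_falling[of 0 s s k] assms p by auto
  then show ?case using Suc assms p by (simp add: zp_of_int_emb zp_sub_emb zp_mul_emb)
qed

lemma zp_binom_emb:
  assumes "s \<in> Zloc p"
  shows "zp_binom p (zp_emb p s) k = zp_emb p (s gchoose k)"
proof -
  have S: "(s gchoose k) \<in> Zloc p" using assms by blast
  have fact_emb: "zp_of_int p (fact k) = zp_emb p (fact k)" using zp_of_int_emb[OF p, of "fact k"] by simp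
  have F: "fact k \<in> Zloc p" using Zloc_of_nat[OF p, of "fact k"] by simp
  show ?thesis unfolding zp_binom_def
  proof (rule the_equality)
    show "zp_emb p (s gchoose k) \<in> Zp p \<and>
        zp_mul p (zp_of_int p (fact k)) (zp_emb p (s gchoose k)) = zp_fallprod p (zp_emb p s) k"
      using S F p assms by (simp add: fact_emb zp_mul_emb zp_fallprod_emb fact_gbinomial zp_emb_Zp)
    fix y assume y: "y \<in> Zp p \<and> zp_mul p (zp_of_int p (fact k)) y = zp_fallprod p (zp_emb p s) k"
    obtain V u where V: "fact k = p ^ V * u" "\<not> p dvd u" using fact_p_decomp by blast
    show "y = zp_emb p (s gchoose k)"
    proof (rule zp_embI[OF p _ S])
      fix n
      \<comment> \<open>Uniqueness requires dividing by \<open>k!\<close>, so the equation is read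
        \<open>V\<close> levels higher than the residue to be determined.\<close>
      let ?m = "n + V"
      have "loc_cong p ?m (of_int (zp_mul p (zp_of_int p (fact k)) y ?m))
          (of_int (zp_of_int p (fact k) ?m) * of_int (y ?m))"
        using loc_cong_mod[OF p, of ?m "zp_of_int p (fact k) ?m * y ?m"] by (simp add: zp_mul_def)
      moreover have "loc_cong p ?m (of_int (zp_of_int p (fact k) ?m) * of_int (y ?m)) (fact k * of_int (y ?m))"
        using loc_cong_mod[OF p, of ?m "fact k"] p
        by (intro loc_cong_mult_right) (auto simp: zp_of_int_def)
      ultimately have "loc_cong p ?m (of_int (zp_mul p (zp_of_int p (fact k)) y ?m)) (fact k * of_int (y ?m))"
        using p loc_cong_trans by blast
      moreover have "loc_cong p ?m (of_int (zp_fallprod p (zp_emb p s) k ?m)) (fact k * (s gchoose k))"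
        unfolding zp_fallprod_emb[OF assms] fact_gbinomial
        using loc_cong_falling[of 0 s s k] assms p by (intro zp_emb_loc_cong) auto
      ultimately have "loc_cong p ?m (fact k * of_int (y ?m)) (fact k * (s gchoose k))"
        using y p loc_cong_trans loc_cong_sym by metis
      moreover have "(fact k :: rat) = of_nat (p ^ V * u)" using V(1) by (metis of_nat_fact)
      ultimately have "loc_cong p n (of_int (y ?m)) (s gchoose k)" using loc_cong_cancel[OF V(2)] by metis
      moreover have "loc_cong p n (of_int (y n)) (of_int (y ?m))"
        using Zp_mono[OF p, of y n ?m] ZpD(3)[OF p, of y n] y p
        by (simp add: loc_cong_of_int_iff cong_def)
      ultimately show "loc_cong p n (of_int (y n)) (s gchoose k)" using p loc_cong_trans by blast
    qed (use y in auto)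
  qed
qed

lemma Zloc_fps_mult:
  assumes "\<And>n. fps_nth f n \<in> Zloc p" "\<And>n. fps_nth g n \<in> Zloc p"
  shows "fps_nth (f * g) n \<in> Zloc p"
  unfolding fps_mult_nth using assms p by (intro Zloc_sum Zloc_mult)

lemma Zloc_fps_power:
  assumes "\<And>n. fps_nth f n \<in> Zloc p"
  shows "fps_nth (f ^ k) n \<in> Zloc p"
proof (induction k arbitrary: n)
  case (Suc k) then show ?case using assms by (simp add: Zloc_fps_mult)
qed (use p in auto)

text \<open>A crude lower bound for the exponent of \<open>p\<close> in a factorial; all truncation
  points \<open>p * N\<close> and \<open>2 * p * N\<close> below come from it.\<close>

lemma p_power_dvd_fact: "p ^ N dvd fact (p * N)"
proof (induction N)
  case (Suc N)
  have "p dvd fact p" using p by (simp add: prime_gt_0_nat dvd_fact Suc_leI)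
  then have "p * p ^ N dvd fact p * fact (p * N)" using Suc by (rule mult_dvd_mono)
  also have "\<dots> dvd fact (p + p * N)" by (rule fact_fact_dvd_fact)
  finally show ?case by simp
qed simp

lemma loc_cong_fact:
  assumes "z \<in> Zloc p" "p * N \<le> q" shows "loc_cong p N (fact q * z) 0"
proof -
  have "p ^ N dvd fact q" using p_power_dvd_fact[of N] fact_dvd[OF assms(2)] dvd_trans by blast
  then obtain c where "fact q = p ^ N * c" by (auto elim: dvdE)
  then have "(fact q :: rat) = of_nat p ^ N * of_nat c" by (metis of_nat_fact of_nat_mult of_nat_power)
  then have "fact q * z = of_nat p ^ N * (of_nat c * z)" by simp
  then show ?thesis unfolding loc_cong_0_iff[OF p] using assms p by (meson Zloc_mult Zloc_of_nat)
qed

end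

section \<open>The formal series \<open>(1 - t)^s\<close> and \<open>exp (f_r)\<close>, and Mahler
  coefficients\<close>

definition one_minus_X_powr :: "rat \<Rightarrow> rat fps" where
  "one_minus_X_powr s = Abs_fps (\<lambda>k. (-1) ^ k * (s gchoose k))"

lemma one_minus_X_powr_add: "one_minus_X_powr (s + t) = one_minus_X_powr s * one_minus_X_powr t"
proof (rule fps_ext)
  fix n
  have "((s + t) gchoose n) = (\<Sum>k=0..n. (s gchoose k) * (t gchoose (n - k)))"
    by (rule gbinomial_Vandermonde[symmetric])
  then show "one_minus_X_powr (s + t) $ n = (one_minus_X_powr s * one_minus_X_powr t) $ n"
    by (simp add: one_minus_X_powr_def fps_mult_nth sum_distrib_left)
      (rule sum.cong, simp, simp add: power_add[symmetric])
qed

lemma one_minus_X_powr_deriv: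
  "fps_deriv (one_minus_X_powr s) = - (fps_const s * one_minus_X_powr (s - 1))"
proof (rule fps_ext)
  fix n
  have "of_nat (Suc n) * (s gchoose Suc n) = s * (s - 1 gchoose n)"
    using gbinomial_absorption'[of "Suc n" s] by simp
  then have "(-1) ^ n * (of_nat (Suc n) * (s gchoose Suc n)) = (-1) ^ n * (s * (s - 1 gchoose n))"
    by simp
  then show "fps_deriv (one_minus_X_powr s) $ n = (- (fps_const s * one_minus_X_powr (s - 1))) $ n"
    by (simp add: one_minus_X_powr_def algebra_simps)
qed

lemma f_r_altdef: "f_r r = - (fps_const r * (one_minus_X_powr (1 / r) - 1))"
  by (rule fps_ext) (simp add: f_r_def one_minus_X_powr_def)

lemma f_r_deriv: "r \<noteq> 0 \<Longrightarrow> fps_deriv (f_r r) = one_minus_X_powr (1 / r - 1)"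
  by (simp add: f_r_altdef one_minus_X_powr_deriv mult.assoc[symmetric])

definition exp_f :: "rat \<Rightarrow> rat fps" where
  "exp_f r = fps_exp 1 oo f_r r"

lemma exp_f_deriv: "r \<noteq> 0 \<Longrightarrow> fps_deriv (exp_f r) = one_minus_X_powr (1 / r - 1) * exp_f r"
  by (simp add: exp_f_def fps_compose_deriv f_r_def[of r] mult.commute f_r_deriv[unfolded f_r_def])

text \<open>Multiplying an exponential generating function by \<open>exp(t)\<close> is the binomial
  transform, so the coefficients of the expansion of \<open>phi\<close> in binomials have generating
  function \<open>exp(-t) exp(f_r) = exp(f_r - t)\<close>.\<close>

definition mahler_coeff :: "rat \<Rightarrow> nat \<Rightarrow> rat" where
  "mahler_coeff r k = fact k * fps_nth (fps_exp 1 oo (f_r r - fps_X)) k"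

lemma fps_linear_ODE_zero:
  fixes Y :: "rat fps"
  assumes "fps_deriv Y = Y * h" "Y $ 0 = 0"
  shows "Y = 0"
proof (rule fps_ext)
  show "Y $ n = 0 $ n" for n
  proof (induction n rule: less_induct)
    case (less n)
    show ?case
    proof (cases n)
      case (Suc m)
      have "of_nat (Suc m) * Y $ Suc m = (Y * h) $ m"
        using arg_cong[OF assms(1), of "\<lambda>f. f $ m"] by simp
      also have "\<dots> = 0" unfolding fps_mult_nth using less Suc by (intro sum.neutral) auto
      finally show ?thesis using Suc by (simp del: of_nat_Suc)
    qed (use assms in simp)
  qed
qed

text \<open>Both sides solve \<open>Y' = Y * f_r'\<close> with constant term 1, and a formal linear
  equation of this kind has only the zero solution with constant term 0.\<close>

lemma exp_f_mahler: "exp_f r = fps_exp 1 * (fps_exp 1 oo (f_r r - fps_X))"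
proof -
  have z: "f_r r $ 0 = 0" "(f_r r - fps_X) $ 0 = 0" by (simp_all add: f_r_def)
  let ?B = "fps_exp 1 oo (f_r r - fps_X)"
  have "fps_exp 1 * ?B - exp_f r = 0"
  proof (rule fps_linear_ODE_zero)
    have B: "fps_deriv ?B = ?B * (fps_deriv (f_r r) - 1)" and E: "fps_deriv (exp_f r) = exp_f r * fps_deriv (f_r r)"
      using fps_compose_deriv[OF z(1), of "fps_exp 1"] fps_compose_deriv[OF z(2), of "fps_exp 1"] by (simp_all add: exp_f_def)
    show "fps_deriv (fps_exp 1 * ?B - exp_f r) = (fps_exp 1 * ?B - exp_f r) * fps_deriv (f_r r)"
      unfolding fps_deriv_sub fps_deriv_mult B E by (simp add: algebra_simps)
    show "(fps_exp 1 * ?B - exp_f r) $ 0 = 0" by (simp add: exp_f_def fps_compose_nth)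
  qed
  then show ?thesis by simp
qed

lemma phi_coeff_mahler: "phi_coeff r n = (\<Sum>k\<le>n. of_nat (n choose k) * mahler_coeff r k)"
proof -
  have "phi_coeff r n = fact n * (\<Sum>i=0..n. (fps_exp 1 oo (f_r r - fps_X)) $ i * (1 / fact (n - i)))"
    unfolding phi_coeff_def exp_f_def[symmetric] exp_f_mahler
    by (subst mult.commute[of "fps_exp 1"]) (simp add: fps_mult_nth)
  also have "\<dots> = (\<Sum>k\<le>n. of_nat (n choose k) * mahler_coeff r k)"
    unfolding sum_distrib_left atLeast0AtMost
    by (rule sum.cong) (simp_all add: mahler_coeff_def binomial_fact)
  finally show ?thesis .
qed

section \<open>Mahler expansion and continuous extension\<close>

lemma fps_square_factor:
  fixes g :: "rat fps"
  assumes "g $ 0 = 0" "g $ 1 = 0"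
  shows "g = fps_X ^ 2 * Abs_fps (\<lambda>n. g $ (n + 2))"
proof (rule fps_ext)
  fix n
  show "g $ n = (fps_X ^ 2 * Abs_fps (\<lambda>n. g $ (n + 2))) $ n"
  proof (cases "n < 2")
    case True
    then have "n = 0 \<or> n = 1" by auto
    then show ?thesis using assms by (auto simp: fps_X_power_mult_nth)
  next
    case False
    then have "n - 2 + 2 = n" by simp
    with False show ?thesis by (simp only: fps_X_power_mult_nth if_False fps_nth_Abs_fps)
  qed
qed

context
  fixes p :: nat and r :: rat
  assumes p: "prime p" and r0: "r \<noteq> 0" and r: "r \<in> Zloc p" "1 / r \<in> Zloc p"
begin

text \<open>With \<open>g = f_r - t\<close>, the coefficient is the sum of
  \<open>(k!/i!) [t^k] g^i\<close>. Since \<open>g^i\<close> starts at \<open>t^(2i)\<close>, only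
  \<open>2i \<le> k\<close> contributes, and then \<open>k!/i! = (k - i)! binom(k, i)\<close> with
  \<open>k - i \<ge> k div 2\<close>.\<close>

lemma mahler_coeff_Zloc: "\<exists>z\<in>Zloc p. mahler_coeff r k = fact (k div 2) * z"
proof -
  define g where "g = f_r r - fps_X"
  define h where "h = Abs_fps (\<lambda>n. g $ (n + 2))"
  \<comment> \<open>The linear coefficient of \<open>f_r\<close> is \<open>r * (1 / r) = 1\<close>;
    subtracting \<open>t\<close> removes exactly this term.\<close>
  have "g $ 0 = 0" "g $ 1 = 0" using r0 by (simp_all add: g_def f_r_def)
  then have gh: "g = fps_X ^ 2 * h" unfolding h_def by (rule fps_square_factor)
  have "h $ n \<in> Zloc p" for n
  proof -
    have "h $ n = (- r * (- 1) ^ (n + 2)) * ((1 / r) gchoose (n + 2))" by (simp add: h_def g_def f_r_def)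
    moreover have "(- 1 :: rat) \<in> Zloc p" using Zloc_of_int[OF p, of "- 1"] by simp
    ultimately show ?thesis
      using p r by (simp only:) (intro Zloc_mult Zloc_power gbinomial_Zloc Zloc_minus[of _ r], auto)
  qed
  then have hi: "(h ^ i) $ n \<in> Zloc p" for i n using Zloc_fps_power[OF p] by blast
  have gi: "(g ^ i) $ k = (if k < 2 * i then 0 else (h ^ i) $ (k - 2 * i))" for i
    by (simp add: gh power_mult_distrib fps_X_power_mult_nth flip: power_mult)
  have "\<exists>z\<in>Zloc p. (fact k / fact i) * (g ^ i) $ k = fact (k div 2) * z" if "i \<le> k" for i
  proof (cases "k < 2 * i")
    case True
    then show ?thesis using p by (intro bexI[of _ 0]) (auto simp: gi)
  next
    case False
    then have "k div 2 \<le> k - i" by linarith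
    then obtain q where q: "(fact (k - i) :: nat) = fact (k div 2) * q" using fact_dvd by (blast elim: dvdE)
    have "(fact k :: rat) = of_nat (fact i * fact (k - i) * (k choose i))"
      using binomial_fact_lemma[OF that] by (metis of_nat_fact)
    also have "\<dots> = fact i * (fact (k div 2) * of_nat (q * (k choose i)))" unfolding q by simp
    finally have "fact k / fact i = (fact (k div 2) * of_nat (q * (k choose i)) :: rat)" by simp
    then have "(fact k / fact i) * (g ^ i) $ k = fact (k div 2) * (of_nat (q * (k choose i)) * (g ^ i) $ k)"
      by simp
    moreover have "of_nat (q * (k choose i)) * (g ^ i) $ k \<in> Zloc p"
      using False hi p by (simp only: gi) (intro Zloc_mult Zloc_of_nat, auto)
    ultimately show ?thesis by blast
  qed
  then obtain z where z: "\<And>i. i \<le> k \<Longrightarrow> z i \<in> Zloc p \<and> (fact k / fact i) * (g ^ i) $ k = fact (k div 2) * z i"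
    by metis
  have "mahler_coeff r k = (\<Sum>i=0..k. (fact k / fact i) * (g ^ i) $ k)"
    by (simp add: mahler_coeff_def fps_compose_nth sum_distrib_left flip: g_def)
  also have "\<dots> = fact (k div 2) * (\<Sum>i=0..k. z i)"
    unfolding sum_distrib_left using z by (intro sum.cong) auto
  finally show ?thesis using z p by (intro bexI[of _ "\<Sum>i=0..k. z i"]) (auto intro!: Zloc_sum)
qed

lemma mahler_coeff_in_Zloc: "mahler_coeff r k \<in> Zloc p"
  using mahler_coeff_Zloc[of k] Zloc_mult[OF p] Zloc_of_nat[OF p, of "fact (k div 2)"] by (metis of_nat_fact)

lemma mahler_coeff_loc_cong: "2 * p * N \<le> k \<Longrightarrow> loc_cong p N (mahler_coeff r k) 0"
  using mahler_coeff_Zloc[of k] loc_cong_fact[OF p, of _ N "k div 2"] by fastforce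

lemma phi_coeff_Zloc: "phi_coeff r n \<in> Zloc p"
  unfolding phi_coeff_mahler using p mahler_coeff_in_Zloc by (intro Zloc_sum Zloc_mult) auto

text \<open>Modulo \<open>p ^ N\<close> the Mahler coefficients beyond \<open>2 * p * N\<close>
  vanish, and the finitely many remaining binomials are uniformly continuous.\<close>

lemma phi_coeff_loc_cong:
  "\<exists>M. \<forall>n n'. [int n = int n'] (mod int p ^ M) \<longrightarrow> loc_cong p N (phi_coeff r n) (phi_coeff r n')"
proof -
  obtain M where M: "\<And>k s s'. k \<le> 2 * p * N \<Longrightarrow> s \<in> Zloc p \<Longrightarrow> s' \<in> Zloc p \<Longrightarrow> loc_cong p M s s'
      \<Longrightarrow> loc_cong p N (s gchoose k) (s' gchoose k)"
    using gbinomial_loc_cong[OF p, of "2 * p * N" N] by metis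
  show ?thesis
  proof (intro exI allI impI)
    fix n n' assume "[int n = int n'] (mod int p ^ M)"
    then have nn: "loc_cong p M (of_nat n) (of_nat n')" using loc_cong_of_int_iff[OF p, of M "int n" "int n'"] by simp
    \<comment> \<open>Both Mahler sums are put on one range; the added binomial coefficients are
      0.\<close>
    define T where "T = max n n'"
    have eq: "phi_coeff r m = (\<Sum>k\<le>T. of_nat (m choose k) * mahler_coeff r k)" if "m \<le> T" for m
      unfolding phi_coeff_mahler using that by (intro sum.mono_neutral_left) auto
    have "loc_cong p N (of_nat (n choose k) * mahler_coeff r k) (of_nat (n' choose k) * mahler_coeff r k)" for k
    proof (cases "k \<le> 2 * p * N")
      case True
      then show ?thesis using M[OF True _ _ nn] p mahler_coeff_in_Zloc
        by (intro loc_cong_mult_right) (auto simp: binomial_gbinomial)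
    next
      case False
      then have "loc_cong p N (of_nat (m choose k) * mahler_coeff r k) 0" for m
        using loc_cong_mult_left[OF p Zloc_of_nat[OF p] mahler_coeff_loc_cong[of N k]] by simp
      then show ?thesis using p loc_cong_trans loc_cong_sym by blast
    qed
    then show "loc_cong p N (phi_coeff r n) (phi_coeff r n')"
      using eq[of n] eq[of n'] p by (simp add: T_def loc_cong_sum)
  qed
qed

text \<open>Existence of the extension comes from the modulus of continuity, uniqueness from the
  density of the natural numbers. Afterwards \<open>phi_rp\<close> is used only through
  approximation by \<open>phi_coeff\<close> at nearby naturals.\<close>

lemma
  shows phi_rp_Zp: "\<And>x. x \<in> Zp p \<Longrightarrow> phi_rp r p x \<in> Zp p"
    and phi_rp_loc_cong: "\<exists>M. \<forall>x\<in>Zp p. \<forall>n. x M = int n mod int p ^ M \<longrightarrow> loc_cong p N (of_int (phi_rp r p x N)) (phi_coeff r n)"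
proof -
  obtain M0 where M0: "\<And>N n n'. [int n = int n'] (mod int p ^ M0 N) \<Longrightarrow> loc_cong p N (phi_coeff r n) (phi_coeff r n')"
    using phi_coeff_loc_cong by metis
  define E where "E n N = zp_emb p (phi_coeff r n) N" for n N
  have Econg: "loc_cong p N (of_int (E n N)) (phi_coeff r n)" for n N
    unfolding E_def by (rule zp_emb_loc_cong[OF p phi_coeff_Zloc])
  have E_eq: "E n N = E n' N" if "[int n = int n'] (mod int p ^ M0 N)" for n n' N
  proof -
    have "loc_cong p N (of_int (E n N)) (of_int (E n' N))"
      using Econg[of N n] Econg[of N n'] M0[OF that] p loc_cong_trans loc_cong_sym by metis
    then show ?thesis using ZpD(3)[OF p zp_emb_Zp[OF p phi_coeff_Zloc]]
      unfolding loc_cong_of_int_iff[OF p] cong_def E_def by metis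
  qed
  \<comment> \<open>The residue at level \<open>N\<close> is computed at the natural number
    representing \<open>x\<close> at level \<open>M0 N\<close>. The value off \<open>Zp p\<close> is
    the one prescribed in the description of \<open>phi_rp\<close>.\<close>
  define f where "f x = (if x \<in> Zp p then (\<lambda>N. E (nat (x (M0 N))) N) else zp_of_int p 0)" for x
  have f_nat: "f x N = E n N" if "x \<in> Zp p" "M0 N \<le> M" "x M = int n mod int p ^ M" for x N n M
  proof -
    have "x (M0 N) = int n mod int p ^ M0 N"
      using Zp_mono[OF p that(1,2)] that(2,3) by (simp add: mod_mod_cancel le_imp_power_dvd)
    moreover have "0 \<le> x (M0 N)" using ZpD(1)[OF p that(1)] .
    ultimately have "[int (nat (x (M0 N))) = int n] (mod int p ^ M0 N)" by (simp add: cong_def)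
    then show ?thesis using that(1) E_eq by (simp add: f_def)
  qed
  have f_self: "f x N = E (nat (x M)) N" if "x \<in> Zp p" "M0 N \<le> M" for x N M
    using f_nat[OF that, of "nat (x M)"] ZpD(1,3)[OF p that(1), of M] by simp
  have fZp: "f x \<in> Zp p" if x: "x \<in> Zp p" for x
  proof (rule ZpI[OF p])
    fix N
    show "f x N = f x N mod int p ^ N" using f_self[OF x order_refl, of N] ZpD(3)[OF p zp_emb_Zp[OF p phi_coeff_Zloc]]
      by (simp add: E_def)
    let ?M = "max (M0 N) (M0 (Suc N))"
    have "f x N = E (nat (x ?M)) N" "f x (Suc N) = E (nat (x ?M)) (Suc N)" using f_self[OF x] by simp_all
    then show "[f x (Suc N) = f x N] (mod int p ^ N)"
      using Zp_cong[OF p zp_emb_Zp[OF p phi_coeff_Zloc]] by (simp add: E_def)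
  qed
  have fcont: "zp_continuous p f" unfolding zp_continuous_def
  proof (intro ballI allI)
    fix x N assume "x \<in> Zp p"
    then show "\<exists>M. \<forall>y\<in>Zp p. y M = x M \<longrightarrow> f y N = f x N" using f_self[OF _ order_refl, of _ N] by metis
  qed
  have fint: "f (zp_of_int p (int n)) = zp_emb p (phi_coeff r n)" for n
    using f_nat[OF zp_of_int_Zp[OF p] order_refl, of "int n" _ n] by (auto simp: E_def zp_of_int_def)
  have "phi_rp r p = f" unfolding phi_rp_def
  proof (rule the_equality)
    show "(\<forall>x\<in>Zp p. f x \<in> Zp p) \<and> (\<forall>x. x \<notin> Zp p \<longrightarrow> f x = zp_of_int p 0) \<and> zp_continuous p f \<and>
        (\<forall>n. zp_is_rat p (f (zp_of_int p (int n))) (phi_coeff r n))"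
      using fZp fcont fint phi_coeff_Zloc p by (simp add: zp_is_rat_iff zp_emb_Zp) (simp add: f_def)
    fix g assume g: "(\<forall>x\<in>Zp p. g x \<in> Zp p) \<and> (\<forall>x. x \<notin> Zp p \<longrightarrow> g x = zp_of_int p 0) \<and> zp_continuous p g \<and>
        (\<forall>n. zp_is_rat p (g (zp_of_int p (int n))) (phi_coeff r n))"
    then have gint: "g (zp_of_int p (int n)) = zp_emb p (phi_coeff r n)" for n
      using zp_is_rat_iff[OF p phi_coeff_Zloc] zp_of_int_Zp[OF p] by blast
    show "g = f"
    proof
      fix x show "g x = f x"
      proof (cases "x \<in> Zp p")
        case x: True
        show ?thesis
        proof
          fix N
          obtain M1 where M1: "\<forall>y\<in>Zp p. y M1 = x M1 \<longrightarrow> g y N = g x N" using g x unfolding zp_continuous_def by blast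
          \<comment> \<open>One natural number has to be close to \<open>x\<close> for both
            functions: \<open>M1\<close> serves the competitor \<open>g\<close>, \<open>M0 N\<close>
            serves \<open>f\<close>.\<close>
          let ?M = "max M1 (M0 N)"
          define n where "n = nat (x ?M)"
          have "int n = x ?M" using ZpD(1)[OF p x] by (simp add: n_def)
          then have "zp_of_int p (int n) M1 = x M1" using Zp_mono[OF p x, of M1 ?M] by (simp add: zp_of_int_def)
          then have "g x N = E n N" using M1 zp_of_int_Zp[OF p] gint unfolding E_def by metis
          then show "g x N = f x N" using f_self[OF x, of N ?M] by (simp add: n_def)
        qed
      qed (use g in \<open>simp add: f_def\<close>)
    qed
  qed
  then show "phi_rp r p x \<in> Zp p" if "x \<in> Zp p" for x using fZp that by simp
  show "\<exists>M. \<forall>x\<in>Zp p. \<forall>n. x M = int n mod int p ^ M \<longrightarrow> loc_cong p N (of_int (phi_rp r p x N)) (phi_coeff r n)"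
    unfolding \<open>phi_rp r p = f\<close> using f_nat[OF _ order_refl, of _ N] Econg by metis
qed

end

section \<open>The values of the p-adic function\<close>

text \<open>At \<open>x = -1\<close> this sign cancels the one in \<open>S_op\<close>, leaving the
  series of \<open>k! binom(s, k) phi(-1 - k)\<close>.\<close>

lemma gbinomial_minus_one: "((-1::rat) gchoose k) = (-1) ^ k"
  using gbinomial_minus[of "1::rat" k] by (simp add: binomial_gbinomial[symmetric])

definition S_coeff :: "rat \<Rightarrow> rat \<Rightarrow> nat \<Rightarrow> rat" where
  "S_coeff r s n = fact n * (one_minus_X_powr s * exp_f r) $ n"

text \<open>This is the series of \<open>S_op\<close> at the natural argument \<open>n\<close>,
  where it stops at \<open>k = n\<close>; it identifies \<open>S_coeff\<close> with the values of
  \<open>S^s(phi)\<close>.\<close>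

lemma S_coeff_sum:
  "S_coeff r s n = (\<Sum>k\<le>n. (-1) ^ k * (fact k * of_nat (n choose k)) * (s gchoose k) * phi_coeff r (n - k))"
  unfolding S_coeff_def fps_mult_nth sum_distrib_left atLeast0AtMost
  by (rule sum.cong)
    (simp_all add: one_minus_X_powr_def phi_coeff_def exp_f_def binomial_fact)

text \<open>The derivative identity for \<open>(1 - t)^(m/r) G\<close>, solved for its last term.
  Taking the derivative turns \<open>n! [t^n]\<close> into the value at
  \<open>Suc n\<close>.\<close>

lemma S_coeff_rec:
  assumes "r \<noteq> 0"
  shows "S_coeff r (of_nat (Suc m) / r - 1) n =
    of_nat m / r * S_coeff r (of_nat m / r - 1) n + S_coeff r (of_nat m / r) (Suc n)"
proof -
  let ?P = one_minus_X_powr and ?G = "exp_f r"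
  have "?P (of_nat (Suc m) / r - 1) = ?P (of_nat m / r) * ?P (1 / r - 1)"
    using one_minus_X_powr_add[of "of_nat m / r" "1 / r - 1"] by (simp add: add_divide_distrib algebra_simps)
  then have "?P (of_nat (Suc m) / r - 1) * ?G =
      fps_const (of_nat m / r) * (?P (of_nat m / r - 1) * ?G) + fps_deriv (?P (of_nat m / r) * ?G)"
    using assms by (simp add: one_minus_X_powr_deriv exp_f_deriv algebra_simps)
  moreover have aux: "fact n * (fps_const c * A + fps_deriv B) $ n = c * (fact n * A $ n) + fact (Suc n) * B $ Suc n"
    for c :: rat and A B by (simp add: algebra_simps)
  ultimately have "fact n * (?P (of_nat (Suc m) / r - 1) * ?G) $ n =
      of_nat m / r * (fact n * (?P (of_nat m / r - 1) * ?G) $ n) + fact (Suc n) * (?P (of_nat m / r) * ?G) $ Suc n"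
    using aux by (simp only:)
  then show ?thesis by (simp only: S_coeff_def)
qed

text \<open>The common value at all places: the sum over \<open>j \<le> m\<close> of
  \<open>(m!/j!) r^(j - m)\<close>, that is, \<open>r^(-m) e^r\<close> times the incomplete gamma
  value \<open>Gamma(m + 1, r)\<close>.\<close>

primrec Psi_normalized :: "rat \<Rightarrow> nat \<Rightarrow> rat" where
  "Psi_normalized r 0 = 1"
| "Psi_normalized r (Suc m) = 1 + of_nat (Suc m) / r * Psi_normalized r m"

context
  fixes p :: nat and r :: rat
  assumes p: "prime p" and r0: "r \<noteq> 0" and r: "r \<in> Zloc p" "1 / r \<in> Zloc p"
begin

text \<open>The term \<open>k = 0\<close> is \<open>phi(p^M)\<close>, which tends to
  \<open>phi(0) = 1\<close>. For \<open>k > 0\<close>,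
  \<open>k! binom(p^M, k) = p^M (k - 1)! binom(p^M - 1, k - 1)\<close> is divisible by
  \<open>p^M\<close>.\<close>

lemma S_coeff_p_power:
  assumes s: "s \<in> Zloc p"
  shows "\<exists>M0. \<forall>M\<ge>M0. loc_cong p N (S_coeff r s (p ^ M)) 1"
proof -
  obtain M1 where M1: "\<And>n n'. [int n = int n'] (mod int p ^ M1) \<Longrightarrow> loc_cong p N (phi_coeff r n) (phi_coeff r n')"
    using phi_coeff_loc_cong[OF p r0 r] by metis
  show ?thesis
  proof (intro exI allI impI)
    fix M assume M: "M \<ge> max N M1"
    have "int p ^ M1 dvd int p ^ M" using M by (simp add: le_imp_power_dvd)
    then have "[int (p ^ M) = int 0] (mod int p ^ M1)" by (simp add: cong_0_iff)
    then have phi: "loc_cong p N (phi_coeff r (p ^ M)) 1"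
      using M1[of "p ^ M" 0] by (simp add: phi_coeff_def)
    let ?f = "\<lambda>k. (-1) ^ k * (fact k * of_nat (p ^ M choose k)) * (s gchoose k) * phi_coeff r (p ^ M - k)"
    have "loc_cong p N (?f k) (if k = 0 then 1 else 0)" for k
    proof (cases k)
      case 0 then show ?thesis using phi by simp
    next
      case (Suc j)
      define z where "z = (-1) ^ k * of_nat (fact j * (p ^ M - 1 choose j)) * (s gchoose k) * phi_coeff r (p ^ M - k)"
      have "k * (p ^ M choose k) = p ^ M * (p ^ M - 1 choose j)"
        using times_binomial_minus1_eq[of k "p ^ M"] Suc by simp
      then have "(of_nat k :: rat) * of_nat (p ^ M choose k) = of_nat p ^ M * of_nat (p ^ M - 1 choose j)"
        by (metis of_nat_mult of_nat_power)
      then have "fact k * of_nat (p ^ M choose k) = (of_nat p ^ M * of_nat (fact j * (p ^ M - 1 choose j)) :: rat)"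
        using Suc by (simp add: mult.commute mult.left_commute del: of_nat_Suc)
      then have "?f k = of_nat p ^ M * z" unfolding z_def by (simp only: mult_ac)
      moreover have "(-1) ^ k \<in> Zloc p" using Zloc_of_int[OF p, of "(-1) ^ k"] by simp
      then have "z \<in> Zloc p" unfolding z_def
        using phi_coeff_Zloc[OF p r0 r] gbinomial_Zloc[OF p s]
        by (intro Zloc_mult[OF p] Zloc_of_nat[OF p])
      ultimately have "loc_cong p M (?f k) 0" using loc_cong_0_iff[OF p] by blast
      then show ?thesis using loc_cong_mono[OF p, of M _ _ N] M Suc by simp
    qed
    then have "loc_cong p N (\<Sum>k\<le>p ^ M. ?f k) (\<Sum>k\<le>p ^ M. if k = 0 then 1 else 0)"
      by (intro loc_cong_sum[OF p])
    then show "loc_cong p N (S_coeff r s (p ^ M)) 1" by (simp add: S_coeff_sum)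
  qed
qed

text \<open>The infinite series at -1 is compared with the finite one at \<open>p^M - 1\<close>:
  factorials kill both tails modulo \<open>p ^ N\<close>, and the remaining terms are congruent one
  by one.\<close>

lemma Phi_rp_approx:
  assumes s: "s \<in> Zloc p"
  shows "Phi_rp r p (zp_emb p s) \<in> Zp p"
    and "\<exists>M0. \<forall>M\<ge>M0. loc_cong p N (of_int (Phi_rp r p (zp_emb p s) N)) (S_coeff r s (p ^ M - 1))"
proof -
  define q where "q k = phi_rp r p (zp_of_int p (-1 - int k))" for k
  define a where "a k = zp_mul p (zp_of_int p ((-1) ^ k * fact k)) (zp_mul p (zp_emb p (s gchoose k))
     (zp_mul p (zp_emb p ((-1) ^ k)) (q k)))" for k
  have m1: "zp_binom p (zp_of_int p (-1)) k = zp_emb p ((-1) ^ k)" for k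
    using zp_binom_emb[OF p Zloc_of_int[OF p], of "-1" k] by (simp add: zp_of_int_emb[OF p] gbinomial_minus_one)
  have sub: "zp_sub p (zp_of_int p (-1)) (zp_of_int p (int k)) = zp_of_int p (-1 - int k)" for k
    by (rule ext) (simp add: zp_sub_def zp_of_int_def mod_diff_eq)
  have Phi: "Phi_rp r p (zp_emb p s) = zp_suminf p a"
    unfolding Phi_rp_def S_op_def m1 sub zp_binom_emb[OF p s] a_def q_def ..
  have qZp: "q k \<in> Zp p" for k unfolding q_def by (rule phi_rp_Zp[OF p r0 r zp_of_int_Zp[OF p]])
  have sgn: "(-1) ^ k \<in> Zloc p" for k using Zloc_of_int[OF p, of "(-1) ^ k"] by simp
  have aZp: "a k \<in> Zp p" for k
    unfolding a_def using p qZp gbinomial_Zloc[OF p s] sgn by (intro zp_mul_Zp zp_of_int_Zp zp_emb_Zp)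
  define t where "t k x = fact k * ((s gchoose k) * x :: rat)" for k x
  have acong: "loc_cong p N (of_int (a k N)) (t k (of_int (q k N)))" for k N
  proof -
    have "loc_cong p N (of_int (a k N)) (of_int ((-1) ^ k * fact k) * ((s gchoose k) * ((-1) ^ k * of_int (q k N))))"
      unfolding a_def
    proof (intro loc_cong_zp_mul[OF p])
      show "loc_cong p N (of_int (zp_of_int p ((-1) ^ k * fact k) N)) (of_int ((-1) ^ k * fact k))"
        unfolding zp_of_int_def by (rule loc_cong_mod[OF p])
    qed (rule zp_emb_loc_cong[OF p] loc_cong_refl[OF p] Zloc_of_int[OF p] gbinomial_Zloc[OF p s] sgn)+
    also have "of_int ((-1) ^ k * fact k) * ((s gchoose k) * ((-1) ^ k * of_int (q k N)))
        = ((-1) ^ k * (-1) ^ k) * t k (of_int (q k N))" by (simp add: t_def mult_ac)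
    finally show ?thesis by (simp flip: power_add)
  qed
  have azero: "a k N = 0" if "p * N \<le> k" for k N
  proof -
    have "(s gchoose k) * of_int (q k N) \<in> Zloc p" using p gbinomial_Zloc[OF p s] by auto
    then have "loc_cong p N (t k (of_int (q k N))) 0" unfolding t_def by (rule loc_cong_fact[OF p _ that])
    then have "loc_cong p N (of_int (a k N)) (of_int 0)" using acong loc_cong_trans[OF p] by fastforce
    then show ?thesis unfolding loc_cong_of_int_iff[OF p] cong_def using ZpD(3)[OF p aZp] by simp
  qed
  have ex: "\<exists>J. \<forall>k\<ge>J. a k N = 0" for N using azero by blast
  show "Phi_rp r p (zp_emb p s) \<in> Zp p" unfolding Phi using aZp ex by (rule zp_suminf_eq(1)[OF p])
  obtain J where J: "\<forall>K\<ge>J. [zp_suminf p a N = (\<Sum>k<K. a k N)] (mod int p ^ N)"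
    using zp_suminf_eq(2)[OF p aZp ex] by blast
  obtain M1 where M1: "\<And>x n. x \<in> Zp p \<Longrightarrow> x M1 = int n mod int p ^ M1 \<Longrightarrow> loc_cong p N (of_int (phi_rp r p x N)) (phi_coeff r n)"
    using phi_rp_loc_cong[OF p r0 r, of N] by blast
  \<comment> \<open>Beyond \<open>J\<close> the partial sums of the p-adic series have their final
    residue; beyond \<open>p * N\<close> the factor \<open>k!\<close> kills the terms of the finite
    sum.\<close>
  define K where "K = max J (p * N)"
  show "\<exists>M0. \<forall>M\<ge>M0. loc_cong p N (of_int (Phi_rp r p (zp_emb p s) N)) (S_coeff r s (p ^ M - 1))"
  proof (intro exI allI impI)
    fix M assume M: "M \<ge> max N (max M1 K)"
    define n where "n = p ^ M - 1"
    \<comment> \<open>This forces \<open>K \<le> n\<close>, so all \<open>K\<close> terms occur in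
      the finite sum and \<open>n - k\<close> is not truncated at 0.\<close>
    have "M < p ^ M" using prime_gt_1_nat[OF p] by (intro power_gt_expt) simp
    then have nK: "K \<le> n" and n1: "int n = int p ^ M - 1" using M by (auto simp: n_def of_nat_diff)
    have minus_one: "(-1 :: rat) \<in> Zloc p" using sgn[of 1] by simp
    have nM: "loc_cong p N (of_nat n) (-1)"
    proof -
      have "[int n = -1] (mod int p ^ M)" unfolding n1 by (simp add: cong_iff_dvd_diff)
      then have "loc_cong p M (of_nat n) (-1)" using loc_cong_of_int_iff[OF p, of M "int n" "-1"] by simp
      then show ?thesis by (rule loc_cong_mono[OF p]) (use M in simp)
    qed
    let ?f = "\<lambda>k. (-1) ^ k * (fact k * of_nat (n choose k)) * (s gchoose k) * phi_coeff r (n - k)"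
    have "loc_cong p N (of_int (Phi_rp r p (zp_emb p s) N)) (of_int (\<Sum>k<K. a k N))"
      unfolding Phi loc_cong_of_int_iff[OF p] using J by (simp add: K_def)
    moreover have "loc_cong p N (of_int (\<Sum>k<K. a k N)) (\<Sum>k<K. ?f k)"
      unfolding of_int_sum
    proof (intro loc_cong_sum[OF p])
      fix k assume k: "k \<in> {..<K}"
      \<comment> \<open>With \<open>k!\<close> attached, the binomial is a falling product, so
        replacing \<open>n\<close> by -1 loses no precision.\<close>
      have "loc_cong p N (fact k * (of_nat n gchoose k)) (fact k * (-1 gchoose k))"
        using loc_cong_falling[OF p nM Zloc_of_nat[OF p] minus_one, of k] unfolding fact_gbinomial by (rule conjunct1)
      from loc_cong_mult_left[OF p sgn[of k] this]
      have "loc_cong p N ((-1) ^ k * (fact k * of_nat (n choose k))) (fact k)"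
        by (simp add: binomial_gbinomial gbinomial_minus_one mult.left_commute flip: power_add)
      then have c1: "loc_cong p N (fact k) ((-1) ^ k * (fact k * of_nat (n choose k)))"
        by (rule loc_cong_sym[OF p])
      have "int (n - k) = -1 - int k + int p ^ M" using k nK n1 by (simp add: of_nat_diff)
      moreover have "int p ^ M1 dvd int p ^ M" using M by (simp add: le_imp_power_dvd)
      ultimately have "[-1 - int k = int (n - k)] (mod int p ^ M1)"
        by (simp add: cong_iff_dvd_diff)
      then have c2: "loc_cong p N (of_int (q k N)) (phi_coeff r (n - k))"
        unfolding q_def by (intro M1 zp_of_int_Zp[OF p]) (simp add: zp_of_int_def cong_def)
      have "fact k * (s gchoose k) \<in> Zloc p"
        using Zloc_mult[OF p Zloc_of_nat[OF p, of "fact k"] gbinomial_Zloc[OF p s]] by simp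
      then have "loc_cong p N (fact k * (s gchoose k) * of_int (q k N)) (fact k * (s gchoose k) * phi_coeff r (n - k))"
        using c2 by (rule loc_cong_mult_left[OF p])
      moreover have "loc_cong p N (fact k * ((s gchoose k) * phi_coeff r (n - k)))
         ((-1) ^ k * (fact k * of_nat (n choose k)) * ((s gchoose k) * phi_coeff r (n - k)))"
        using c1 gbinomial_Zloc[OF p s] phi_coeff_Zloc[OF p r0 r]
        by (intro loc_cong_mult_right[OF p] Zloc_mult[OF p])
      ultimately show "loc_cong p N (of_int (a k N)) (?f k)"
        using acong[of N k] loc_cong_trans[OF p] unfolding t_def mult.assoc by blast
    qed
    moreover have "loc_cong p N (\<Sum>k<K. ?f k) (\<Sum>k\<le>n. ?f k)"
    proof -
      have "loc_cong p N (\<Sum>k\<le>n. if k < K then ?f k else 0) (\<Sum>k\<le>n. ?f k)"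
      proof (intro loc_cong_sum[OF p])
        fix k
        have eq: "?f k = fact k * ((-1) ^ k * of_nat (n choose k) * (s gchoose k) * phi_coeff r (n - k))"
          by (simp only: mult_ac)
        have "loc_cong p N (?f k) 0" if "K \<le> k"
          unfolding eq using that sgn p gbinomial_Zloc[OF p s] phi_coeff_Zloc[OF p r0 r]
          by (intro loc_cong_fact[OF p] Zloc_mult[OF p]) (auto simp: K_def)
        then show "loc_cong p N (if k < K then ?f k else 0) (?f k)"
          using p loc_cong_sym by auto
      qed
      moreover have "(\<Sum>k\<le>n. if k < K then ?f k else 0) = (\<Sum>k<K. ?f k)"
        using nK by (intro sum.mono_neutral_cong_right) auto
      ultimately show ?thesis by simp
    qed
    ultimately show "loc_cong p N (of_int (Phi_rp r p (zp_emb p s) N)) (S_coeff r s (p ^ M - 1))"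
      unfolding S_coeff_sum n_def[symmetric] using loc_cong_trans[OF p] by blast
  qed
qed

lemma Psi_arg_Zloc: "of_nat m / r \<in> Zloc p" "of_nat m / r - 1 \<in> Zloc p"
proof -
  show "of_nat m / r \<in> Zloc p" using Zloc_mult[OF p Zloc_of_nat[OF p, of m] r(2)] by simp
  then show "of_nat m / r - 1 \<in> Zloc p" using p by blast
qed

lemma Psi_normalized_Zloc: "Psi_normalized r m \<in> Zloc p"
proof (induction m)
  case (Suc m)
  then show ?case unfolding Psi_normalized.simps by (intro Zloc_add[OF p] Zloc_mult[OF p] Psi_arg_Zloc Zloc_1[OF p])
qed (use p in auto)

lemma S_coeff_pred_p_power:
  "\<exists>M0. \<forall>M\<ge>M0. loc_cong p N (S_coeff r (of_nat (Suc m) / r - 1) (p ^ M - 1)) (Psi_normalized r m)"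
proof (induction m)
  case 0
  obtain M0 where M0: "\<And>M. M \<ge> M0 \<Longrightarrow> loc_cong p N (S_coeff r 0 (p ^ M)) 1"
    using S_coeff_p_power[of 0 N] p by auto
  \<comment> \<open>For \<open>m = 0\<close> the recursion loses its first term, because its factor
    \<open>m / r\<close> is 0.\<close>
  have "S_coeff r (of_nat (Suc 0) / r - 1) (p ^ M - 1) = S_coeff r 0 (p ^ M)" for M
    using S_coeff_rec[OF r0, of 0 "p ^ M - 1"] p by (simp add: prime_gt_0_nat)
  then show ?case using M0 by auto
next
  case (Suc m)
  let ?s = "of_nat (Suc m) / r"
  obtain M0 where M0: "\<And>M. M \<ge> M0 \<Longrightarrow> loc_cong p N (S_coeff r (?s - 1) (p ^ M - 1)) (Psi_normalized r m)"
    using Suc by blast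
  obtain M1 where M1: "\<And>M. M \<ge> M1 \<Longrightarrow> loc_cong p N (S_coeff r ?s (p ^ M)) 1"
    using S_coeff_p_power[OF Psi_arg_Zloc(1)] by blast
  show ?case
  proof (intro exI allI impI)
    fix M assume M: "M \<ge> max M0 M1"
    have "S_coeff r (of_nat (Suc (Suc m)) / r - 1) (p ^ M - 1) = ?s * S_coeff r (?s - 1) (p ^ M - 1) + S_coeff r ?s (p ^ M)"
      using S_coeff_rec[OF r0, of "Suc m" "p ^ M - 1"] p by (simp add: prime_gt_0_nat)
    moreover have "loc_cong p N \<dots> (?s * Psi_normalized r m + 1)"
      using M0[of M] M1[of M] M by (intro loc_cong_add[OF p] loc_cong_mult_left[OF p Psi_arg_Zloc(1)]) auto
    ultimately show "loc_cong p N (S_coeff r (of_nat (Suc (Suc m)) / r - 1) (p ^ M - 1)) (Psi_normalized r (Suc m))"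
      by (simp add: add.commute)
  qed
qed

lemma Phi_rp_value:
  "Phi_rp r p (zp_emb p (of_nat (Suc m) / r - 1)) = zp_emb p (Psi_normalized r m)"
proof (rule zp_embI[OF p Phi_rp_approx(1)[OF Psi_arg_Zloc(2)] Psi_normalized_Zloc])
  fix N
  let ?s = "of_nat (Suc m) / r - 1"
  obtain M0 M1 where "\<forall>M\<ge>M0. loc_cong p N (of_int (Phi_rp r p (zp_emb p ?s) N)) (S_coeff r ?s (p ^ M - 1))"
    "\<forall>M\<ge>M1. loc_cong p N (S_coeff r ?s (p ^ M - 1)) (Psi_normalized r m)"
    using Phi_rp_approx(2)[OF Psi_arg_Zloc(2)] S_coeff_pred_p_power by meson
  then show "loc_cong p N (of_int (Phi_rp r p (zp_emb p ?s) N)) (Psi_normalized r m)"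
    using loc_cong_trans[OF p] by (meson max.cobounded1 max.cobounded2)
qed

end

section \<open>Teichmueller representatives and p-adic powers\<close>

context
  fixes p :: nat
  assumes p: "prime p"
begin

text \<open>In \<open>x^p - y^p = (x - y) * \<Sigma>\<close> the second factor is congruent to
  \<open>p * y^(p - 1)\<close>, hence to 0, modulo \<open>p\<close>; each \<open>p\<close>-th power
  gains one digit.\<close>

lemma cong_prime_power_lift:
  fixes a b :: int
  assumes "[a = b] (mod int p)"
  shows "[a ^ (p ^ j) = b ^ (p ^ j)] (mod int p ^ Suc j)"
proof (induction j)
  case (Suc j)
  define x y where "x = a ^ (p ^ j)" and "y = b ^ (p ^ j)"
  have xy: "int p ^ Suc j dvd x - y" using Suc by (simp add: x_def y_def cong_iff_dvd_diff)
  then have "[x = y] (mod int p)" by (metis cong_iff_dvd_diff dvd_trans dvd_power zero_less_Suc)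
  then have "[(\<Sum>i<p. y ^ (p - Suc i) * x ^ i) = (\<Sum>i<p. y ^ (p - Suc i) * y ^ i)] (mod int p)"
    by (intro cong_sum cong_mult cong_pow cong_refl)
  also have "(\<Sum>i<p. y ^ (p - Suc i) * y ^ i) = (\<Sum>i<p. y ^ (p - 1))"
    by (intro sum.cong) (auto simp flip: power_add)
  also have "[\<dots> = 0] (mod int p)" by (simp add: cong_0_iff)
  finally have "int p dvd (\<Sum>i<p. y ^ (p - Suc i) * x ^ i)" by (simp add: cong_0_iff)
  then have "int p ^ Suc j * int p dvd (x - y) * (\<Sum>i<p. y ^ (p - Suc i) * x ^ i)"
    using xy by (intro mult_dvd_mono)
  also have "\<dots> = x ^ p - y ^ p" by (rule power_diff_sumr2[symmetric])
  finally show ?case by (simp add: cong_iff_dvd_diff x_def y_def mult.commute flip: power_mult)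
qed (use assms in simp)

lemma fermat_int:
  fixes a :: int
  assumes "\<not> int p dvd a"
  shows "[a ^ (p - 1) = 1] (mod int p)"
proof -
  define b where "b = nat (a mod int p)"
  have "int b = a mod int p" using p by (simp add: b_def prime_gt_0_nat)
  then have ab: "[a = int b] (mod int p)" by (simp add: cong_def)
  then have "\<not> p dvd b" using assms by (simp add: cong_dvd_iff)
  then have "[b ^ (p - 1) = 1] (mod p)" by (rule fermat_theorem[OF p])
  then have "[int (b ^ (p - 1)) = int 1] (mod int p)" by (simp only: cong_int_iff)
  then show ?thesis using cong_trans[OF cong_pow[OF ab]] by simp
qed

lemma Zp_not_dvd:
  assumes "x \<in> Zp p" "\<not> int p dvd x 1" "n > 0" shows "\<not> int p dvd x n"
  using Zp_mono[OF p assms(1), of 1 n] assms(2,3) by (auto simp: dvd_eq_mod_eq_0)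

lemma zp_pow_eq_one_iff: "x \<in> Zp p \<Longrightarrow> zp_pow p x k = zp_of_int p 1 \<longleftrightarrow> (\<forall>n. [x n ^ k = 1] (mod int p ^ n))"
proof -
  assume x: "x \<in> Zp p"
  have "zp_pow p x k = zp_of_int p 1 \<longleftrightarrow> (\<forall>n. zp_pow p x k n mod int p ^ n = 1 mod int p ^ n)"
    using ZpD(3)[OF p zp_pow_Zp[OF p x]] by (auto simp: fun_eq_iff zp_of_int_def)
  then show ?thesis using zp_pow_cong[OF p, of x k] by (simp add: cong_def)
qed

text \<open>The uniqueness half of Hensel's lemma for \<open>X^m - 1\<close>, with common exponent
  \<open>m = k * l\<close>. The cofactor of \<open>v - w\<close> in \<open>v^m - w^m\<close> is
  congruent to \<open>m * w^(m - 1)\<close>, a unit modulo \<open>p\<close>.\<close>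

lemma root_of_unity_unique:
  assumes "v \<in> Zp p" "w \<in> Zp p" "v 1 = w 1" "\<not> int p dvd w 1"
    and "zp_pow p v k = zp_of_int p 1" "zp_pow p w l = zp_of_int p 1" "\<not> p dvd k" "\<not> p dvd l"
  shows "v = w"
proof (rule Zp_eqI[OF p assms(1,2)])
  fix n
  define m where "m = k * l"
  show "[v n = w n] (mod int p ^ n)"
  proof (cases "n = 0")
    case False
    have vw: "[v n = w n] (mod int p)"
      using Zp_mono[OF p assms(1), of 1 n] Zp_mono[OF p assms(2), of 1 n] assms(3) False by (simp add: cong_def)
    have "[(v n ^ k) ^ l = 1 ^ l] (mod int p ^ n)" "[(w n ^ l) ^ k = 1 ^ k] (mod int p ^ n)"
      using assms by (auto simp: zp_pow_eq_one_iff intro!: cong_pow simp del: power_one)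
    then have "[v n ^ m = 1] (mod int p ^ n)" "[w n ^ m = 1] (mod int p ^ n)"
      by (simp_all add: m_def power_mult[symmetric] mult.commute)
    then have "[v n ^ m = w n ^ m] (mod int p ^ n)" using cong_trans cong_sym by blast
    then have dvd: "int p ^ n dvd (v n - w n) * (\<Sum>i<m. w n ^ (m - Suc i) * v n ^ i)"
      by (simp only: cong_iff_dvd_diff power_diff_sumr2)
    have "[(\<Sum>i<m. w n ^ (m - Suc i) * v n ^ i) = (\<Sum>i<m. w n ^ (m - Suc i) * w n ^ i)] (mod int p)"
      using vw by (intro cong_sum cong_mult cong_pow cong_refl)
    also have "(\<Sum>i<m. w n ^ (m - Suc i) * w n ^ i) = (\<Sum>i<m. w n ^ (m - 1))"
      by (intro sum.cong) (auto simp flip: power_add)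
    also have "\<dots> = int m * w n ^ (m - 1)" by simp
    finally have "[(\<Sum>i<m. w n ^ (m - Suc i) * v n ^ i) = int m * w n ^ (m - 1)] (mod int p)" .
    moreover have "\<not> int p dvd int m * w n ^ (m - 1)"
      using p assms(7,8) Zp_not_dvd[OF assms(2,4)] False
      by (auto simp: prime_dvd_mult_iff m_def dest: prime_dvd_power[rotated])
    ultimately have "\<not> int p dvd (\<Sum>i<m. w n ^ (m - Suc i) * v n ^ i)" by (simp add: cong_dvd_iff)
    then have "coprime (int p ^ n) (\<Sum>i<m. w n ^ (m - Suc i) * v n ^ i)"
      using p by (simp add: prime_imp_coprime)
    then show ?thesis using dvd by (simp add: coprime_dvd_mult_left_iff cong_iff_dvd_diff)
  qed simp
qed

lemma prime_pred_pos_not_dvd: "p - 1 > 0" "\<not> p dvd p - 1"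
  using prime_gt_1_nat[OF p] by (auto dest: dvd_imp_le)

lemma teich_props:
  assumes x: "x \<in> Zp p" "\<not> int p dvd x 1"
  shows "teich p x \<in> Zp p" "zp_pow p (teich p x) (p - 1) = zp_of_int p 1" "teich p x 1 = x 1"
proof -
  \<comment> \<open>The classical limit of \<open>x^(p^n)\<close>; modulo \<open>p ^ n\<close> it is
    already reached at the \<open>n\<close>-th term.\<close>
  define w where "w n = x n ^ (p ^ n) mod int p ^ n" for n
  have unit: "[x n ^ (p ^ n * (p - 1)) = 1] (mod int p ^ n)" for n
  proof (cases "n = 0")
    case False
    have "[(x n ^ (p - 1)) ^ (p ^ n) = 1 ^ (p ^ n)] (mod int p ^ Suc n)"
      using Zp_not_dvd[OF x] False by (intro cong_prime_power_lift fermat_int) auto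
    then have "[x n ^ (p ^ n * (p - 1)) = 1] (mod int p ^ Suc n)" by (simp add: mult.commute flip: power_mult)
    then show ?thesis by (rule cong_dvd_modulus) simp
  qed simp
  have wZp: "w \<in> Zp p"
  proof (rule ZpI[OF p])
    show "w n = x n ^ (p ^ n) mod int p ^ n" for n by (simp add: w_def)
    show "[x (Suc n) ^ (p ^ Suc n) = x n ^ (p ^ n)] (mod int p ^ n)" for n
    proof -
      \<comment> \<open>Consecutive terms differ by the factor \<open>x^(p^n * (p - 1))\<close>,
        which is 1 modulo \<open>p ^ n\<close>.\<close>
      have "p ^ Suc n = p ^ n * (p - 1) + p ^ n"
        using prime_gt_0_nat[OF p] by (simp add: algebra_simps)
      then have "x n ^ (p ^ Suc n) = x n ^ (p ^ n * (p - 1)) * x n ^ (p ^ n)" by (simp only: power_add)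
      also have "[\<dots> = 1 * x n ^ (p ^ n)] (mod int p ^ n)" using unit by (intro cong_mult cong_refl)
      finally have "[x n ^ (p ^ Suc n) = x n ^ (p ^ n)] (mod int p ^ n)" by simp
      then show ?thesis using cong_trans[OF cong_pow[OF Zp_cong[OF p x(1)]]] by blast
    qed
  qed
  have "[w n ^ (p - 1) = 1] (mod int p ^ n)" for n
  proof -
    have "[w n ^ (p - 1) = (x n ^ (p ^ n)) ^ (p - 1)] (mod int p ^ n)"
      unfolding w_def by (intro cong_pow) (simp add: cong_def)
    then show ?thesis using unit[of n] cong_trans by (simp add: power_mult) blast
  qed
  then have w1: "zp_pow p w (p - 1) = zp_of_int p 1" using zp_pow_eq_one_iff[OF wZp] by blast
  have wx: "w 1 = x 1"
  proof -
    have "x 1 ^ p = x 1 ^ (p - 1) * x 1" using prime_gt_0_nat[OF p] by (metis power_minus_mult)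
    also have "[\<dots> = 1 * x 1] (mod int p)" using fermat_int[OF x(2)] by (intro cong_mult cong_refl)
    finally show ?thesis using ZpD(3)[OF p x(1), of 1] by (simp add: w_def cong_def)
  qed
  have "teich p x = w" unfolding teich_def
  proof (rule the_equality)
    show "w \<in> Zp p \<and> (\<exists>k>0. \<not> p dvd k \<and> zp_pow p w k = zp_of_int p 1) \<and> w 1 = x 1"
      using wZp w1 wx prime_pred_pos_not_dvd by blast
  next
    fix v assume "v \<in> Zp p \<and> (\<exists>k>0. \<not> p dvd k \<and> zp_pow p v k = zp_of_int p 1) \<and> v 1 = x 1"
    then show "v = w"
      using root_of_unity_unique[of v w _ "p - 1"] wZp w1 wx prime_pred_pos_not_dvd(2) x(2) by metis
  qed
  then show "teich p x \<in> Zp p" "zp_pow p (teich p x) (p - 1) = zp_of_int p 1" "teich p x 1 = x 1"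
    using wZp w1 wx by simp_all
qed

lemma zp_inv_eqI:
  assumes "x \<in> Zp p" "y \<in> Zp p" "zp_mul p x y = zp_of_int p 1"
  shows "zp_inv p x = y"
  unfolding zp_inv_def
proof (rule the_equality)
  show "y \<in> Zp p \<and> zp_mul p x y = zp_of_int p 1" using assms by simp
  fix z assume z: "z \<in> Zp p \<and> zp_mul p x z = zp_of_int p 1"
  show "z = y"
  proof (rule Zp_eqI[OF p])
    fix n
    have y1: "[x n * y n = 1] (mod int p ^ n)" and z1: "[x n * z n = 1] (mod int p ^ n)"
      using fun_cong[OF assms(3), of n] fun_cong[OF conjunct2[OF z], of n]
      by (simp_all add: zp_mul_def zp_of_int_def cong_def)
    have "[z n * (x n * y n) = z n * 1] (mod int p ^ n)" using y1 by (intro cong_mult cong_refl)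
    moreover have "[y n * (x n * z n) = y n * 1] (mod int p ^ n)" using z1 by (intro cong_mult cong_refl)
    ultimately show "[z n = y n] (mod int p ^ n)"
      by (simp add: mult_ac) (metis cong_sym cong_trans)
  qed (use z assms in auto)
qed

text \<open>The last claim is the origin of \<open>ell\<close>: the Teichmueller factor has order
  dividing \<open>p - 1\<close>, so it disappears from \<open>m\<close>-th powers when
  \<open>p - 1\<close> divides \<open>m\<close>.\<close>

lemma bracket_props:
  assumes x: "x \<in> Zp p" "\<not> int p dvd x 1"
  shows "bracket p x \<in> Zp p"
    and "n > 0 \<Longrightarrow> [bracket p x n = 1] (mod int p)"
    and "(p - 1) dvd m \<Longrightarrow> [bracket p x n ^ m = x n ^ m] (mod int p ^ n)"
proof -
  define w where "w = teich p x"
  note w = teich_props[OF x, folded w_def]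
  \<comment> \<open>The inverse of a root of unity of order dividing \<open>p - 1\<close>; for
    \<open>p = 2\<close> the exponent is 0 and \<open>w\<close> itself is 1.\<close>
  define y where "y = zp_pow p w (p - 2)"
  have "p - 1 = Suc (p - 2)" using prime_gt_1_nat[OF p] by simp
  then have wy: "zp_mul p w y = zp_of_int p 1" using w(2) by (simp add: y_def)
  have yZp: "y \<in> Zp p" unfolding y_def using w p by simp
  have inv: "zp_inv p w = y" using zp_inv_eqI[OF w(1) yZp wy] .
  have br: "bracket p x = zp_mul p x y" unfolding bracket_def w_def[symmetric] inv ..
  then show bZp: "bracket p x \<in> Zp p" using x yZp p by simp
  have wyn: "[w n * y n = 1] (mod int p ^ n)" for n
    using fun_cong[OF wy, of n] by (simp add: zp_mul_def zp_of_int_def cong_def)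
  have brn: "[bracket p x n = x n * y n] (mod int p ^ n)" for n
    by (simp add: br zp_mul_def cong_def)
  show "[bracket p x n = 1] (mod int p)" if "n > 0"
  proof -
    have "[bracket p x 1 = 1] (mod int p)" using brn[of 1] wyn[of 1] w(3) cong_trans by simp blast
    moreover have "[bracket p x n = bracket p x 1] (mod int p)"
      using Zp_mono[OF p bZp, of 1 n] that by (metis One_nat_def Suc_leI cong_mod_left cong_refl power_one_right cong_sym)
    ultimately show ?thesis using cong_trans by blast
  qed
  show "[bracket p x n ^ m = x n ^ m] (mod int p ^ n)" if dvd: "(p - 1) dvd m"
  proof -
    obtain l where l: "m = (p - 1) * l" using dvd by (auto elim: dvdE)
    have "[(w n ^ (p - 1)) ^ l = 1 ^ l] (mod int p ^ n)"
      using w(2) zp_pow_eq_one_iff[OF w(1)] by (intro cong_pow) blast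
    then have wm: "[w n ^ m = 1] (mod int p ^ n)" by (simp add: l flip: power_mult)
    have "[bracket p x n ^ m * 1 = bracket p x n ^ m * w n ^ m] (mod int p ^ n)"
      using wm by (intro cong_mult cong_refl) (rule cong_sym)
    also have "bracket p x n ^ m * w n ^ m = (bracket p x n * w n) ^ m" by (simp add: power_mult_distrib)
    also have "[\<dots> = (x n * y n * w n) ^ m] (mod int p ^ n)" using brn by (intro cong_pow cong_mult cong_refl)
    also have "(x n * y n * w n) ^ m = (x n * (w n * y n)) ^ m" by (simp only: mult_ac)
    also have "[\<dots> = (x n * 1) ^ m] (mod int p ^ n)" using wyn by (intro cong_pow cong_mult cong_refl)
    finally show ?thesis by simp
  qed
qed

section \<open>Binomial powers of principal units at integer exponents\<close>

text \<open>By Pascal's rule the only error of the truncated series is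
  \<open>binom(a, N - 1) d^N\<close>. The relation allows induction on the exponent in both
  directions.\<close>

lemma truncated_binomial_step:
  fixes a d :: rat
  assumes "loc_cong p N (d ^ N) 0" "N > 0" "a \<in> Zloc p"
  shows "loc_cong p N ((\<Sum>k<N. (a gchoose k) * d ^ k) * (1 + d)) (\<Sum>k<N. ((a + 1) gchoose k) * d ^ k)"
proof -
  obtain n where n: "N = Suc n" using assms(2) gr0_implies_Suc by blast
  have "(\<Sum>k<N. ((a + 1) gchoose k) * d ^ k) = 1 + (\<Sum>k<n. ((a gchoose k) + (a gchoose Suc k)) * d ^ Suc k)"
    unfolding n sum.lessThan_Suc_shift by (simp add: gbinomial_Suc_Suc)
  also have "\<dots> = (1 + (\<Sum>k<n. (a gchoose Suc k) * d ^ Suc k)) + d * (\<Sum>k<n. (a gchoose k) * d ^ k)"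
    by (simp add: algebra_simps sum.distrib sum_distrib_left)
  also have "1 + (\<Sum>k<n. (a gchoose Suc k) * d ^ Suc k) = (\<Sum>k<N. (a gchoose k) * d ^ k)"
    unfolding n sum.lessThan_Suc_shift by simp
  finally have "(\<Sum>k<N. (a gchoose k) * d ^ k) * (1 + d) =
      (\<Sum>k<N. ((a + 1) gchoose k) * d ^ k) + (a gchoose n) * d ^ N"
    by (simp add: n algebra_simps)
  moreover have "loc_cong p N ((a gchoose n) * d ^ N) 0"
    using loc_cong_mult_left[OF p gbinomial_Zloc[OF p assms(3)] assms(1)] by simp
  ultimately show ?thesis
    using loc_cong_add[OF p loc_cong_refl[OF p, of N "\<Sum>k<N. ((a + 1) gchoose k) * d ^ k"]] by fastforce
qed

text \<open>Level by level the series is the truncated sum \<open>T N\<close>, as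
  \<open><x> - 1\<close> is divisible by \<open>p\<close>. The negative power is described through
  its product with the positive one, which avoids inverting residues.\<close>

lemma bracket_pow_props:
  assumes x: "x \<in> Zp p" "\<not> int p dvd x 1"
  shows "bracket_pow p x (zp_of_int p s) \<in> Zp p"
    and "loc_cong p N (of_int (bracket_pow p x (zp_of_int p (int m)) N)) (of_int (bracket p x N) ^ m)"
    and "loc_cong p N (of_int (bracket_pow p x (zp_of_int p (- int m)) N) * of_int (bracket p x N) ^ m) 1"
proof -
  define u where "u = bracket p x"
  note u = bracket_props[OF x, folded u_def]
  define b where "b s k = zp_mul p (zp_emb p (of_int s gchoose k)) (zp_pow p (zp_sub p u (zp_of_int p 1)) k)" for s :: int and k
  have bp: "bracket_pow p x (zp_of_int p s) = zp_suminf p (b s)" for s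
    unfolding bracket_pow_def b_def u_def zp_of_int_emb[OF p, of s] zp_binom_emb[OF p Zloc_of_int[OF p]] ..
  have gZ: "(of_int s gchoose k) \<in> Zloc p" for s :: int and k by (rule gbinomial_Zloc[OF p Zloc_of_int[OF p]])
  have bZp: "b s k \<in> Zp p" for s k unfolding b_def using u(1) p gZ by (intro zp_mul_Zp zp_emb_Zp zp_pow_Zp zp_sub_Zp zp_of_int_Zp)
  define d where "d N = u N - 1" for N
  have bcong: "loc_cong p N (of_int (b s k N)) ((of_int s gchoose k) * of_int (d N) ^ k)" for s k N
  proof -
    have "[zp_sub p u (zp_of_int p 1) N = d N] (mod int p ^ N)"
      by (simp add: zp_sub_def zp_of_int_def d_def cong_def mod_diff_right_eq)
    then have "[zp_pow p (zp_sub p u (zp_of_int p 1)) k N = d N ^ k] (mod int p ^ N)"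
      using cong_trans[OF zp_pow_cong[OF p] cong_pow] by blast
    then have "loc_cong p N (of_int (zp_pow p (zp_sub p u (zp_of_int p 1)) k N)) (of_int (d N ^ k))"
      by (simp only: loc_cong_of_int_iff[OF p])
    then have "loc_cong p N (of_int (zp_emb p (of_int s gchoose k) N) * of_int (zp_pow p (zp_sub p u (zp_of_int p 1)) k N))
        ((of_int s gchoose k) * of_int (d N ^ k))"
      using p by (intro loc_cong_mult zp_emb_loc_cong gZ) auto
    then show ?thesis
      using loc_cong_trans[OF p loc_cong_mod[OF p]] by (simp add: b_def zp_mul_def)
  qed
  have d0: "loc_cong p N (of_int (d N) ^ k) 0" if "N \<le> k" for N k
  proof (cases "N = 0")
    case True then show ?thesis unfolding loc_cong_0_iff[OF p] using Zloc_power[OF p Zloc_of_int[OF p]] by auto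
  next
    case False
    then have "int p dvd d N" using u(2)[of N] by (simp add: d_def cong_iff_dvd_diff)
    then have "int p ^ k dvd d N ^ k" by (rule dvd_power_same)
    then have "int p ^ N dvd d N ^ k" using le_imp_power_dvd[OF that] dvd_trans by blast
    then show ?thesis using loc_cong_of_int_iff[OF p, of N "d N ^ k" 0] by (simp add: cong_0_iff)
  qed
  have b0: "b s k N = 0" if "N \<le> k" for s k N
  proof -
    have "loc_cong p N ((of_int s gchoose k) * of_int (d N) ^ k) 0"
      using loc_cong_mult_left[OF p gZ d0[OF that]] by simp
    then have "loc_cong p N (of_int (b s k N)) (of_int 0)" using bcong loc_cong_trans[OF p] by fastforce
    then show ?thesis using ZpD(3)[OF p bZp] by (simp only: loc_cong_of_int_iff[OF p] cong_def) simp
  qed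
  then have ex: "\<exists>J. \<forall>k\<ge>J. b s k N = 0" for s N by blast
  show "bracket_pow p x (zp_of_int p s) \<in> Zp p" unfolding bp by (rule zp_suminf_eq(1)[OF p bZp ex])
  define T where "T N a = (\<Sum>k<N. (a gchoose k) * of_int (d N) ^ k :: rat)" for N a
  have bpT: "loc_cong p N (of_int (bracket_pow p x (zp_of_int p s) N)) (T N (of_int s))" for s N
  proof -
    obtain J where J: "\<And>K. K \<ge> J \<Longrightarrow> [zp_suminf p (b s) N = (\<Sum>k<K. b s k N)] (mod int p ^ N)"
      using zp_suminf_eq(2)[OF p bZp ex] by blast
    have "(\<Sum>k<max J N. b s k N) = (\<Sum>k<N. b s k N)"
      by (rule sum.mono_neutral_right) (use b0 in auto)
    then have "[bracket_pow p x (zp_of_int p s) N = (\<Sum>k<N. b s k N)] (mod int p ^ N)"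
      using J[of "max J N"] by (simp add: bp)
    then have "loc_cong p N (of_int (bracket_pow p x (zp_of_int p s) N)) (\<Sum>k<N. of_int (b s k N))"
      by (simp flip: loc_cong_of_int_iff[OF p])
    moreover have "loc_cong p N (\<Sum>k<N. of_int (b s k N)) (T N (of_int s))"
      unfolding T_def using bcong by (intro loc_cong_sum[OF p])
    ultimately show ?thesis using loc_cong_trans[OF p] by blast
  qed
  have ud: "of_int (u N) = 1 + (of_int (d N) :: rat)" for N by (simp add: d_def)
  have uZ: "of_int (u N) ^ m \<in> Zloc p" for N m using p by auto
  \<comment> \<open>At level 0 the sum \<open>T 0\<close> is empty instead of being 1 at exponent 0;
    congruence modulo 1 of p-integral numbers is automatic there.\<close>
  have triv: "loc_cong p 0 y z" if "y \<in> Zloc p" "z \<in> Zloc p" for y z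
    unfolding loc_cong_def using Zloc_diff[OF p that] by auto
  have step: "loc_cong p N (T N a * of_int (u N)) (T N (a + 1))" if "N > 0" "a \<in> Zloc p" for a N
    unfolding T_def ud using that by (intro truncated_binomial_step d0) auto
  have T0: "T N 0 = 1" if "N > 0" for N
    using that by (cases N) (auto simp: T_def sum.lessThan_Suc_shift simp del: sum.lessThan_Suc)
  have "loc_cong p N (T N (of_nat m)) (of_int (u N) ^ m)" if "N > 0" for N
  proof (induction m)
    case (Suc m)
    have "loc_cong p N (T N (of_nat m) * of_int (u N)) (of_int (u N) ^ m * of_int (u N))"
      using Suc by (intro loc_cong_mult_right[OF p]) (use p in auto)
    then have "loc_cong p N (T N (of_nat m + 1)) (of_int (u N) ^ m * of_int (u N))"
      using step[OF that Zloc_of_nat[OF p, of m]] loc_cong_trans[OF p] loc_cong_sym[OF p] by blast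
    then show ?case by (simp add: mult.commute add.commute)
  qed (use T0[OF that] p in auto)
  then show "loc_cong p N (of_int (bracket_pow p x (zp_of_int p (int m)) N)) (of_int (bracket p x N) ^ m)"
    unfolding u_def[symmetric] using loc_cong_trans[OF p bpT[of N "int m"]] triv[OF Zloc_of_int[OF p] uZ]
    by (cases "N = 0") simp_all
  have "loc_cong p N (T N (- of_nat m) * of_int (u N) ^ m) 1" if "N > 0" for N
  proof (induction m)
    case (Suc m)
    have "- of_nat (Suc m) + 1 = - (of_nat m :: rat)" by simp
    then have "loc_cong p N (T N (- of_nat (Suc m)) * of_int (u N)) (T N (- of_nat m))"
      using step[OF that Zloc_minus[OF p Zloc_of_nat[OF p]], of "Suc m"] by (simp only:)
    then have "loc_cong p N (T N (- of_nat (Suc m)) * of_int (u N) * of_int (u N) ^ m) (T N (- of_nat m) * of_int (u N) ^ m)"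
      using uZ by (intro loc_cong_mult_right[OF p])
    then show ?case using Suc loc_cong_trans[OF p] by (simp only: power_Suc mult.assoc)
  qed (use T0[OF that] p in auto)
  moreover have "loc_cong p N (of_int (bracket_pow p x (zp_of_int p (- int m)) N) * of_int (u N) ^ m) (T N (- of_nat m) * of_int (u N) ^ m)"
    using bpT[of N "- int m"] uZ by (intro loc_cong_mult_right[OF p]) simp_all
  ultimately have "N > 0 \<Longrightarrow> loc_cong p N (of_int (bracket_pow p x (zp_of_int p (- int m)) N) * of_int (u N) ^ m) 1"
    using loc_cong_trans[OF p] by blast
  then show "loc_cong p N (of_int (bracket_pow p x (zp_of_int p (- int m)) N) * of_int (bracket p x N) ^ m) 1"
    unfolding u_def[symmetric] using triv[OF Zloc_mult[OF p Zloc_of_int[OF p] uZ] Zloc_1[OF p]]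
    by (cases "N = 0") simp_all
qed

end

section \<open>The archimedean place and comparison\<close>

text \<open>On a bounded box the restricted integrand is handled by the fundamental theorem; the
  limit of \<open>F\<close> then controls all sufficiently large boxes.\<close>

lemma has_integral_atLeast_FTC:
  fixes F f :: "real \<Rightarrow> real"
  assumes F: "\<And>x. (F has_real_derivative f x) (at x)" and lim: "(F \<longlongrightarrow> L) at_top"
  shows "(f has_integral (L - F a)) {a..}"
  unfolding has_integral_alt'
proof (intro conjI allI impI)
  have FTC: "(f has_integral (F d - F c)) {c..d}" if "c \<le> d" for c d
    using that F by (intro fundamental_theorem_of_calculus)
      (auto simp: has_real_derivative_iff_has_vector_derivative[symmetric] intro: has_field_derivative_at_within)
  have restr: "{a..} \<inter> cbox c d = {max c a..d}" for c d :: real by (auto simp: box_real)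
  have int: "f integrable_on {c..d}" for c d
    using FTC[of c d] by (cases "c \<le> d") (auto simp: has_integral_integrable)
  show "(\<lambda>x. if x \<in> {a..} then f x else 0) integrable_on cbox c d" for c d
    unfolding integrable_restrict_Int restr by (rule int)
  fix e :: real assume "e > 0"
  then have "\<forall>\<^sub>F x in at_top. dist (F x) L < e" using lim tendstoD by blast
  then obtain B where B: "\<And>x. x \<ge> B \<Longrightarrow> dist (F x) L < e" by (auto simp: eventually_at_top_linorder)
  show "\<exists>B>0. \<forall>c d. ball 0 B \<subseteq> cbox c d \<longrightarrow>
      norm (integral (cbox c d) (\<lambda>x. if x \<in> {a..} then f x else 0) - (L - F a)) < e"
  proof (intro exI[of _ "max 1 (max B \<bar>a\<bar>)"] conjI allI impI)
    fix c d :: real assume "ball 0 (max 1 (max B \<bar>a\<bar>)) \<subseteq> cbox c d"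
    then have "{- max 1 (max B \<bar>a\<bar>)<..<max 1 (max B \<bar>a\<bar>)} \<subseteq> {c..d}"
      by (simp add: ball_eq_greaterThanLessThan)
    then have cd: "c \<le> - max 1 (max B \<bar>a\<bar>)" "max 1 (max B \<bar>a\<bar>) \<le> d"
      unfolding greaterThanLessThan_subseteq_atLeastAtMost_iff by linarith+
    \<comment> \<open>The radius also dominates the absolute value of \<open>a\<close>, so cutting a
      large box at \<open>a\<close> leaves \<open>{a..d}\<close>, with \<open>d\<close> beyond
      \<open>B\<close>.\<close>
    then have "max c a = a" "a \<le> d" "B \<le> d" by linarith+
    then have "integral (cbox c d) (\<lambda>x. if x \<in> {a..} then f x else 0) = F d - F a"
      using FTC[of a d] by (simp only: integral_restrict_Int restr integral_unique)
    then show "norm (integral (cbox c d) (\<lambda>x. if x \<in> {a..} then f x else 0) - (L - F a)) < e"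
      using B[OF \<open>B \<le> d\<close>] by (simp add: dist_real_def)
  qed simp
qed

text \<open>The polynomial for which \<open>- exp (- u) * exp_poly m u\<close> is a primitive of
  \<open>u ^ m * exp (- u)\<close>; its recursion is integration by parts.\<close>

fun exp_poly :: "nat \<Rightarrow> real \<Rightarrow> real" where
  "exp_poly 0 u = 1"
| "exp_poly (Suc m) u = u ^ Suc m + real (Suc m) * exp_poly m u"

lemma exp_poly_deriv: "(exp_poly m has_real_derivative (exp_poly m u - u ^ m)) (at u)"
proof (induction m)
  case (Suc m)
  have "((\<lambda>u. u ^ Suc m + real (Suc m) * exp_poly m u) has_real_derivative
      (real (Suc m) * u ^ m + real (Suc m) * (exp_poly m u - u ^ m))) (at u)"
    using DERIV_add[OF DERIV_pow[of "Suc m"] DERIV_cmult[OF Suc]] by simp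
  then show ?case by (simp add: algebra_simps)
qed simp

lemma exp_poly_tendsto: "((\<lambda>u. - (exp (- u) * exp_poly m u)) \<longlongrightarrow> 0) at_top"
proof (induction m)
  case 0
  show ?case using tendsto_minus[OF tendsto_power_div_exp_0[of 0]] by (simp add: exp_minus field_simps)
next
  case (Suc m)
  have "((\<lambda>u. - (u ^ Suc m / exp u) + real (Suc m) * - (exp (- u) * exp_poly m u)) \<longlongrightarrow> - 0 + real (Suc m) * 0) at_top"
    by (intro tendsto_intros tendsto_power_div_exp_0 Suc)
  moreover have "(\<lambda>u. - (u ^ Suc m / exp u) + real (Suc m) * - (exp (- u) * exp_poly m u))
      = (\<lambda>u. - (exp (- u) * exp_poly (Suc m) u))"
    by (simp add: fun_eq_iff exp_minus divide_inverse algebra_simps)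
  ultimately show ?case by simp
qed

text \<open>The primitive vanishes at infinity, so only the lower end contributes and
  \<open>e^r\<close> cancels; multiplying the recursion of \<open>Psi_normalized\<close> by
  \<open>r^(m + 1)\<close> gives that of \<open>exp_poly\<close>.\<close>

lemma Psi_inf_value:
  assumes "r \<noteq> 0" shows "Psi_inf r m = real_of_rat (r ^ m * Psi_normalized r m)"
proof -
  let ?x = "real_of_rat r"
  have "((\<lambda>u. u ^ m * exp (- u)) has_integral (0 - (- (exp (- ?x) * exp_poly m ?x)))) {?x..}"
    by (rule has_integral_atLeast_FTC[OF _ exp_poly_tendsto])
      (auto intro!: derivative_eq_intros exp_poly_deriv simp: algebra_simps)
  then have "Psi_inf r m = exp_poly m ?x"
    unfolding Psi_inf_def by (simp add: integral_unique exp_minus)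
  also have "\<dots> = real_of_rat (r ^ m * Psi_normalized r m)"
    using assms by (induction m) (simp_all add: of_rat_add of_rat_mult of_rat_power of_rat_divide field_simps)
  finally show ?thesis .
qed

section \<open>Comparison of the values at different places\<close>

text \<open>Coprime numerator and denominator cannot both be divisible by \<open>p\<close>, so equal
  multiplicities must both be 0 and \<open>r\<close> is a unit at \<open>p\<close>.\<close>

lemma admissible_prime_Zloc:
  assumes p: "prime p" and "p \<notin> P_r r" "r \<noteq> 0"
  shows "r \<in> Zloc p" "1 / r \<in> Zloc p" "\<not> int p dvd zp_emb p r 1"
proof -
  obtain a b where q: "quotient_of r = (a, b)" by fastforce
  have ab: "b > 0" "coprime a b" "r = of_int a / of_int b"
    using q quotient_of_denom_pos quotient_of_coprime quotient_of_div by auto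
  have a0: "a \<noteq> 0" using ab assms(3) by auto
  have m: "multiplicity (int p) a = multiplicity (int p) b" using assms q by (simp add: P_r_def)
  have pi: "prime (int p)" using p by simp
  have "\<not> (int p dvd a \<and> int p dvd b)"
    using ab(2) pi by (meson coprime_common_divisor not_prime_unit)
  moreover have "int p dvd a \<longleftrightarrow> int p dvd b"
    using m a0 ab(1) prime_elem_multiplicity_eq_zero_iff[OF prime_imp_prime_elem[OF pi]] by (metis less_irrefl)
  ultimately have nd: "\<not> int p dvd a" "\<not> int p dvd b" by auto
  show r: "r \<in> Zloc p" using ab nd unfolding Zloc_def by blast
  have "1 / r = of_int b / of_int a" using ab by simp
  then show ri: "1 / r \<in> Zloc p" using nd unfolding Zloc_def by blast
  show "\<not> int p dvd zp_emb p r 1"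
  proof
    assume "int p dvd zp_emb p r 1"
    then have "loc_cong p 1 (of_int (zp_emb p r 1)) (of_int 0)"
      unfolding loc_cong_of_int_iff[OF p] by (simp add: cong_0_iff)
    then have "loc_cong p 1 (of_int (zp_emb p r 1)) 0" by simp
    then have "loc_cong p 1 r 0" using loc_cong_trans[OF p loc_cong_sym[OF p zp_emb_loc_cong[OF p r]]] by blast
    then have "loc_cong p 1 (1 / r * r) (1 / r * 0)" by (rule loc_cong_mult_left[OF p ri])
    then have "loc_cong p 1 (of_int 1) (of_int 0)" using assms(3) by simp
    then show False using p unfolding loc_cong_of_int_iff[OF p] by (auto simp: cong_0_iff dest: prime_gt_1_nat)
  qed
qed

lemma Psi_rp_value:
  assumes p: "prime p" and "p \<notin> P_r r" "r \<noteq> 0"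
  shows "Psi_rp r p (zp_of_int p (int m)) =
    zp_mul p (bracket_pow p (zp_emb p r) (zp_of_int p (int m))) (zp_emb p (Psi_normalized r m))"
proof -
  note r = admissible_prime_Zloc[OF assms]
  have ri: "inverse r \<in> Zloc p" using r(2) by (simp add: divide_inverse)
  have "zp_sub p (zp_mul p (zp_add p (zp_of_int p (int m)) (zp_of_int p 1)) (zp_of_rat p (inverse r))) (zp_of_int p 1)
     = zp_emb p ((of_int (int m) + of_int 1) * inverse r - of_int 1)"
    using p ri by (simp only: zp_of_rat_emb zp_of_int_emb zp_add_emb zp_mul_emb zp_sub_emb
        Zloc_of_int Zloc_add Zloc_mult)
  also have "(of_int (int m) + of_int 1) * inverse r - of_int 1 = of_nat (Suc m) / r - 1"
    by (simp add: divide_inverse add.commute)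
  finally show ?thesis
    unfolding Psi_rp_def zp_of_rat_emb[OF p r(1)] using Phi_rp_value[OF p assms(3) r(1,2)] by simp
qed

text \<open>The two opposite powers of \<open><r>\<close> cancel, leaving the value of
  \<open>Phi\<close>; the witness depends on \<open>r\<close> and \<open>m\<close> but not on the
  place.\<close>

lemma normPsi_is_rat_value:
  assumes "r \<noteq> 0" "admissible r v"
  shows "normPsi_is_rat r v m (Psi_normalized r m)"
proof (cases v)
  case InfPlace
  then show ?thesis using assms(1)
    by (simp add: normPsi_is_rat_def Psi_inf_value of_rat_mult of_rat_power power_int_minus field_simps)
next
  case (PrimePlace p)
  then have p: "prime p" "p \<notin> P_r r" using assms(2) by (auto simp: admissible_def)
  note r = admissible_prime_Zloc[OF p assms(1)]
  let ?c = "Psi_normalized r m" and ?b = "\<lambda>k. bracket_pow p (zp_emb p r) (zp_of_int p k)"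
    and ?u = "bracket p (zp_emb p r)"
  note b = bracket_pow_props[OF p(1) zp_emb_Zp[OF p(1) r(1)] r(3)]
  have c: "?c \<in> Zloc p" using Psi_normalized_Zloc[OF p(1) assms(1) r(1,2)] .
  have "zp_mul p (?b (- int m)) (zp_mul p (?b (int m)) (zp_emb p ?c)) = zp_emb p ?c"
  proof (rule zp_embI[OF p(1) _ c])
    fix N
    have "loc_cong p N (of_int (zp_mul p (?b (- int m)) (zp_mul p (?b (int m)) (zp_emb p ?c)) N))
        (of_int (?b (- int m) N) * (of_int (?u N) ^ m * ?c))"
      using p(1) c by (intro loc_cong_zp_mul loc_cong_refl b(2) zp_emb_loc_cong) auto
    moreover have "loc_cong p N (of_int (?b (- int m) N) * of_int (?u N) ^ m * ?c) (1 * ?c)"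
      using b(3) c by (intro loc_cong_mult_right[OF p(1)])
    ultimately show "loc_cong p N (of_int (zp_mul p (?b (- int m)) (zp_mul p (?b (int m)) (zp_emb p ?c)) N)) ?c"
      using loc_cong_trans[OF p(1)] by (simp add: mult.assoc)
  qed (use b(1) p(1) c in \<open>intro zp_mul_Zp zp_emb_Zp\<close>)
  then show ?thesis using PrimePlace p c
    by (simp add: normPsi_is_rat_def Psi_rp_value[OF p assms(1)] zp_of_rat_emb r(1) zp_is_rat_iff zp_emb_Zp)
qed

text \<open>Divisibility by \<open>ell v\<close> makes \<open><r>^m\<close> equal to
  \<open>r^m\<close> at a prime, matching the factor \<open>r^m\<close> at infinity.\<close>

lemma Psi_is_rat_value:
  assumes "r \<noteq> 0" "admissible r v" "ell v dvd m"
  shows "Psi_is_rat r v m (r ^ m * Psi_normalized r m)"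
proof (cases v)
  case InfPlace
  then show ?thesis using assms(1) by (simp add: Psi_is_rat_def Psi_inf_value)
next
  case (PrimePlace p)
  then have p: "prime p" "p \<notin> P_r r" and m: "(p - 1) dvd m"
    using assms(2,3) by (auto simp: admissible_def ell_def)
  note r = admissible_prime_Zloc[OF p assms(1)]
  note e = zp_emb_Zp[OF p(1) r(1)]
  let ?c = "Psi_normalized r m" and ?b = "bracket_pow p (zp_emb p r) (zp_of_int p (int m))"
    and ?u = "bracket p (zp_emb p r)"
  note b = bracket_pow_props[OF p(1) e r(3)]
  have c: "?c \<in> Zloc p" using Psi_normalized_Zloc[OF p(1) assms(1) r(1,2)] .
  have rm: "r ^ m \<in> Zloc p" using r(1) p(1) by blast
  have "?b = zp_emb p (r ^ m)"
  proof (rule zp_embI[OF p(1) b(1) rm])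
    fix N
    have "loc_cong p N (of_int (?u N ^ m)) (of_int (zp_emb p r N ^ m))"
      unfolding loc_cong_of_int_iff[OF p(1)] by (rule bracket_props(3)[OF p(1) e r(3) m])
    moreover have "loc_cong p N (of_int (zp_emb p r N) ^ m) (r ^ m)"
    proof (induction m)
      case (Suc m)
      show ?case
        using loc_cong_mult[OF p(1) zp_emb_loc_cong[OF p(1) r(1)] Suc r(1) Zloc_power[OF p(1) Zloc_of_int[OF p(1)]]]
        by simp
    qed (use p in auto)
    ultimately have "loc_cong p N (of_int (?u N) ^ m) (r ^ m)"
      unfolding of_int_power by (rule loc_cong_trans[OF p(1)])
    with b(2) show "loc_cong p N (of_int (?b N)) (r ^ m)" by (rule loc_cong_trans[OF p(1)])
  qed
  then have "Psi_rp r p (zp_of_int p (int m)) = zp_emb p (r ^ m * ?c)"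
    using Psi_rp_value[OF p assms(1)] zp_mul_emb[OF p(1) rm c] by simp
  then show ?thesis using PrimePlace zp_is_rat_iff[OF p(1)] Zloc_mult[OF p(1) rm c] zp_emb_Zp[OF p(1)]
    by (simp add: Psi_is_rat_def)
qed

theorem theorem9p4:
  fixes r :: rat
  assumes "r \<noteq> 0"
  shows "(\<forall>v w m. admissible r v \<longrightarrow> admissible r w \<longrightarrow>
            (\<exists>c::rat. normPsi_is_rat r v m c \<and> normPsi_is_rat r w m c))
       \<and> (\<forall>v w m. admissible r v \<longrightarrow> admissible r w \<longrightarrow> v \<noteq> w \<longrightarrow>
            lcm (ell v) (ell w) dvd m \<longrightarrow>
            (\<exists>c::rat. Psi_is_rat r v m c \<and> Psi_is_rat r w m c))"
  using normPsi_is_rat_value[OF assms] Psi_is_rat_value[OF assms]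
  by (meson dvd_lcm1 dvd_lcm2 dvd_trans)

end
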